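(* Let $(\phi,\mu,\theta,\mathbf{u},p)$ be a classical solution on $[0,T]\times\Omega$ of the non-isothermal Cahn-Hilliard-Navier-Stokes system \begin{align*} \partial_t\phi &+ \mathbf{u}\cdot\nabla\phi - \operatorname{div}(\mathbf{L}_{11}\nabla\mu - \mathbf{L}_{12}\nabla\theta) = 0, \qquad \mu = -\gamma\Delta\phi + \partial_\phi \Psi(\phi,\theta),\\ \partial_t e &+ \mathbf{u}\cdot\nabla e - \operatorname{div}(\mathbf{L}_{12}\nabla\mu- \mathbf{L}_{22}\nabla \theta ) - (\eta\,\mathrm{D}\mathbf{u}- \boldsymbol{\sigma}):\nabla\mathbf{u} = 0,\\ \partial_t\mathbf{u} &+ (\mathbf{u}\cdot\nabla)\mathbf{u} - \operatorname{div}(\eta\,\mathrm{D}\mathbf{u} - p\mathbf{I} - \boldsymbol{\sigma}) = 0, \qquad \operatorname{div}(\mathbf{u})=0 \end{align*} with periodic boundary conditions. Set $\pi := p + e - \frac{s+\phi\mu}{\theta}$. Then, at every $t\in(0,T]$, \begin{align*} 0 &= \langle \partial_t\phi,\psi \rangle - \langle \phi\mathbf{u},\nabla\psi\rangle + \langle \mathbf{L}_{11}\nabla\mu - \mathbf{L}_{12}\nabla\theta,\nabla\psi \rangle,\\ 0 &= \langle \mu,\xi \rangle - \gamma\langle \nabla\phi,\nabla\xi \rangle - \langle \partial_\phi \Psi,\xi\rangle,\\ 0 &= \langle \partial_t e,w \rangle + \langle \mathbf{L}_{12}\nabla\mu - \mathbf{L}_{22}\nabla\theta, \nabla w\rangle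 - \langle \eta|\mathrm{D}\mathbf{u}|^2, w\rangle - \langle \boldsymbol{\sigma}\mathbf{u},\nabla w \rangle\\ &\quad - \left\langle \tfrac{\phi}{\theta}\nabla\mu- \boldsymbol{\sigma}\tfrac{\nabla\theta}{\theta},\mathbf{u} w\right\rangle - \left\langle s+\phi\mu,\mathbf{u}\cdot\nabla\tfrac{w}{\theta} \right\rangle,\\ 0 &= \langle \partial_t\mathbf{u},\mathbf{v} \rangle + \mathbf{c}_{skw}(\mathbf{u},\mathbf{u},\mathbf{v}) + \langle \eta\,\mathrm{D}\mathbf{u},\mathrm{D}\mathbf{v} \rangle - \langle \pi,\operatorname{div}(\mathbf{v}) \rangle\\ &\quad + \left\langle \tfrac{\phi}{\theta}\nabla\mu + (s+\phi\mu)\nabla\tfrac{1}{\theta}-\boldsymbol{\sigma}\tfrac{\nabla\theta}{\theta},\mathbf{v} \right\rangle,\\ 0 &= \langle \operatorname{div}(\mathbf{u}), q \rangle \end{align*} for all spatially periodic test functions $\psi,\xi,w,q\in C^1(\bar\Omega)$ and all spatially periodic vector fields $\mathbf{v}\in C^1(\bar\Omega)^d$.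
   Context: Setting: $d\in\{2,3\}$, $T>0$, $\Omega\subset\mathbb{R}^d$ is a square/cube identified with the $d$-dimensional torus; all functions on $\Omega$ are periodic. $\langle u,v\rangle=\int_\Omega u\cdot v$ is the $L^2(\Omega)$ scalar product (for scalars, vectors and matrices, with the Euclidean/Frobenius product), and $A:B$ is the Frobenius product. Unknowns: $\phi$ (phase field), $\mu$ (chemical potential), $\theta>0$ (inverse temperature), $\mathbf{u}$ (velocity, $\mathbb{R}^d$-valued), $p$ (pressure). $\mathrm{D}\mathbf{u}=\tfrac12(\nabla\mathbf{u}+\nabla\mathbf{u}^\top)$ is the symmetric gradient. Constitutive relations: $\tilde\Psi(\phi,\theta)=\Psi(\phi,\theta)+\tfrac{\gamma}{2}|\nabla\phi|^2$ is the Helmholtz free energy density, $\boldsymbol{\sigma}=\tfrac{\gamma}{\theta}\nabla\phi\otimes\nabla\phi$ the Korteweg stress, $e=e(\phi,\theta)=\partial_\theta\tilde\Psi=\partial_\theta\Psi(\phi,\theta)$ the internal energy, $s=s(\phi,\theta)=\theta e-\tilde\Psi$ the entropy (containing the term $-\tfrac{\gamma}{2}|\nabla\phi|^2$). Skew-symmetric form: $\mathbf{c}(\mathbf{u},\mathbf{v},\mathbf{w})=\langle(\mathbf{u}\cdot\nabla)\mathbf{v},\mathbf{w}\rangle$ and $\mathbf{c}_{skw}(\mathbf{u},\mathbf{v},\mathbf{w})=\tfrac12\mathbf{c}(\mathbf{u},\mathbf{v},\mathbf{w})-\tfrac12\mathbf{c}(\mathbf{u},\mathbf{w},\mathbf{v})$.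 Standing assumptions: (A1) $\gamma$ is a positive constant. (A2) The viscosity function $\eta=\eta(\phi,\theta)$ is strictly positive. (A3) The diffusion matrix $\mathbf{L}=\mathbf{L}(\phi,\nabla\phi,\theta)=\begin{pmatrix}\mathbf{L}_{11}&-\mathbf{L}_{12}\\-\mathbf{L}_{12}&\mathbf{L}_{22}\end{pmatrix}\in\mathbb{R}^{2d\times2d}$ (with $d\times d$ blocks) is symmetric and strictly positive definite, and $\mathbf{L}_{12}$ is symmetric. (A4) $\Psi:\mathbb{R}\times\mathbb{R}_+\to\mathbb{R}$, $\mathbb{R}_+=(0,\infty)$: for every fixed $\phi$, $\Psi(\phi,\cdot)$ is concave and $|\Psi(\phi,\theta)|\to\infty$ as $\theta\to0$; for every fixed $\theta$, $\Psi(\cdot,\theta)=\Psi_{vex}(\cdot,\theta)+\Psi_{cav}(\cdot,\theta)$ with $\Psi_{vex}(\cdot,\theta)$ strictly convex and $\Psi_{cav}(\cdot,\theta)$ strictly concave. Moreover $\Psi$ is $C^2$ and $\eta,\mathbf{L}$ are $C^1$ functions of their arguments, so that all terms in the system make classical sense. Classical solution: the system holds pointwise for every $(t,x)\in(0,T]\times\Omega$, $\theta>0$, and $\phi\in C^1([0,T],C^4(\bar\Omega))$, $\mu\in C^0([0,T],C^2(\bar\Omega))$, $\theta\in C^1([0,T],C^2(\bar\Omega))$, $\mathbf{u}\in C^1([0,T],C^2(\bar\Omega))$, $p\in C^0([0,T],C^4(\bar\Omega))$. *)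

theory Defs
  imports "HOL-Analysis.Analysis"
begin

text \<open>
  \<open>iter_deriv [b\<^sub>1, \<dots>, b\<^sub>m] f\<close> is the iterated directional derivative of \<open>f\<close>, first along
  \<open>b\<^sub>1\<close> and last along \<open>b\<^sub>m\<close>; the lists of length \<open>m\<close> over \<open>Basis\<close> enumerate all partial derivatives
  of order \<open>m\<close>.
\<close>

primrec iter_deriv ::
    "'a list \<Rightarrow> ('a::euclidean_space \<Rightarrow> 'b::real_normed_vector) \<Rightarrow> 'a \<Rightarrow> 'b" where
  "iter_deriv [] f = f"
| "iter_deriv (b # bs) f = iter_deriv bs (\<lambda>x. frechet_derivative f (at x) b)"

text \<open>Only meaningful for open \<open>S\<close>, since the derivatives are taken in full neighbourhoods.\<close>

definition Ck_on :: "nat \<Rightarrow> ('a::euclidean_space \<Rightarrow> 'b::real_normed_vector) \<Rightarrow> 'a set \<Rightarrow> bool" where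
  "Ck_on k f S \<longleftrightarrow>
     (\<forall>bs. set bs \<subseteq> Basis \<and> length bs < k \<longrightarrow> (\<forall>x\<in>S. iter_deriv bs f differentiable (at x))) \<and>
     (\<forall>bs. set bs \<subseteq> Basis \<and> length bs \<le> k \<longrightarrow> continuous_on S (iter_deriv bs f))"

text \<open>
  Functions on the torus of side length \<open>l\<close> are represented by the \<open>l\<close>-periodic functions on the
  whole space, and \<open>C\<^sup>k\<close> functions on the torus by the periodic \<open>C\<^sup>k\<close> functions.
\<close>

definition periodic :: "real \<Rightarrow> (real^'n \<Rightarrow> 'b) \<Rightarrow> bool" where
  "periodic l f \<longleftrightarrow> (\<forall>x i. f (x + l *\<^sub>R axis i 1) = f x)"

definition Ck_per :: "real \<Rightarrow> nat \<Rightarrow> (real^'n \<Rightarrow> 'b::real_normed_vector) \<Rightarrow> bool" where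
  "Ck_per l k f \<longleftrightarrow> periodic l f \<and> Ck_on k f UNIV"

text \<open>Convergence with respect to the \<open>C\<^sup>k\<close> norm, the maximum of the sup norms of all partial
  derivatives of order at most \<open>k\<close>.\<close>

definition Ck_tendsto ::
    "nat \<Rightarrow> ('i \<Rightarrow> 'a::euclidean_space \<Rightarrow> 'b::real_normed_vector) \<Rightarrow> ('a \<Rightarrow> 'b) \<Rightarrow> 'i filter \<Rightarrow> bool" where
  "Ck_tendsto k f g F \<longleftrightarrow>
     (\<forall>bs. set bs \<subseteq> Basis \<and> length bs \<le> k \<longrightarrow>
        uniform_limit UNIV (\<lambda>r. iter_deriv bs (f r)) (iter_deriv bs g) F)"

text \<open>\<open>C\<^sup>0([0,T], C\<^sup>k)\<close> and \<open>C\<^sup>1([0,T], C\<^sup>k)\<close>, as spaces of curves in the normed space \<open>C\<^sup>k\<close> of the torus.\<close>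

definition C0_Ck :: "real \<Rightarrow> real \<Rightarrow> nat \<Rightarrow> (real \<Rightarrow> real^'n \<Rightarrow> 'b::real_normed_vector) \<Rightarrow> bool" where
  "C0_Ck l T k f \<longleftrightarrow>
     (\<forall>t\<in>{0..T}. Ck_per l k (f t) \<and> Ck_tendsto k f (f t) (at t within {0..T}))"

definition C1_Ck :: "real \<Rightarrow> real \<Rightarrow> nat \<Rightarrow> (real \<Rightarrow> real^'n \<Rightarrow> 'b::real_normed_vector) \<Rightarrow> bool" where
  "C1_Ck l T k f \<longleftrightarrow>
     (\<forall>t\<in>{0..T}. Ck_per l k (f t)) \<and>
     (\<exists>f'. C0_Ck l T k f' \<and>
       (\<forall>t\<in>{0..T}. Ck_tendsto k (\<lambda>r x. (f r x - f t x) /\<^sub>R (r - t)) (f' t) (at t within {0..T})))"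

text \<open>The time derivative is one-sided at the end points of \<open>[0,T]\<close>.\<close>

definition time_deriv :: "real \<Rightarrow> (real \<Rightarrow> 'a \<Rightarrow> 'b::real_normed_vector) \<Rightarrow> real \<Rightarrow> 'a \<Rightarrow> 'b" where
  "time_deriv T f t x = vector_derivative (\<lambda>r. f r x) (at t within {0..T})"

definition grad :: "(real^'n \<Rightarrow> real) \<Rightarrow> real^'n \<Rightarrow> real^'n" where
  "grad f x = (\<chi> i. frechet_derivative f (at x) (axis i 1))"

text \<open>The gradient of a vector field \<open>u\<close> is \<^term>\<open>jacobian u (at x)\<close>, with \<open>(i,j)\<close> entry
  \<open>\<partial>\<^sub>j u\<^sub>i\<close>. Hence \<open>(w \<cdot> \<nabla>)u\<close> is \<^term>\<open>jacobian u (at x) *v w\<close>.\<close>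

definition sym_grad :: "(real^'n \<Rightarrow> real^'n) \<Rightarrow> real^'n \<Rightarrow> real^'n^'n" where
  "sym_grad u x = (1/2) *\<^sub>R (jacobian u (at x) + transpose (jacobian u (at x)))"

definition divergence :: "(real^'n \<Rightarrow> real^'n) \<Rightarrow> real^'n \<Rightarrow> real" where
  "divergence u x = trace (jacobian u (at x))"

definition matrix_divergence :: "(real^'n \<Rightarrow> real^'n^'n) \<Rightarrow> real^'n \<Rightarrow> real^'n" where
  "matrix_divergence A x = (\<chi> i. divergence (\<lambda>y. A y $ i) x)"

definition laplacian :: "(real^'n \<Rightarrow> real) \<Rightarrow> real^'n \<Rightarrow> real" where
  "laplacian f x = divergence (grad f) x"

definition cube :: "real^'n \<Rightarrow> real \<Rightarrow> (real^'n) set" where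
  "cube a l = cbox a (\<chi> i. a $ i + l)"

text \<open>On matrices, \<^term>\<open>A \<bullet> B\<close> is the Frobenius product.\<close>

definition L2_inner ::
    "(real^'n \<Rightarrow> 'b::real_inner) \<Rightarrow> (real^'n \<Rightarrow> 'b) \<Rightarrow> (real^'n) set \<Rightarrow> real"
    (\<open>\<langle>_,/ _\<rangle>\<^bsub>_\<^esub>\<close>) where
  "\<langle>f, g\<rangle>\<^bsub>\<Omega>\<^esub> = integral \<Omega> (\<lambda>x. f x \<bullet> g x)"

definition conv ::
    "(real^'n) set \<Rightarrow> (real^'n \<Rightarrow> real^'n) \<Rightarrow> (real^'n \<Rightarrow> real^'n) \<Rightarrow> (real^'n \<Rightarrow> real^'n) \<Rightarrow> real" where
  "conv \<Omega> u v w = \<langle>\<lambda>x. jacobian v (at x) *v u x, w\<rangle>\<^bsub>\<Omega>\<^esub>"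

definition conv_skw ::
    "(real^'n) set \<Rightarrow> (real^'n \<Rightarrow> real^'n) \<Rightarrow> (real^'n \<Rightarrow> real^'n) \<Rightarrow> (real^'n \<Rightarrow> real^'n) \<Rightarrow> real" where
  "conv_skw \<Omega> u v w = 1/2 * conv \<Omega> u v w - 1/2 * conv \<Omega> u w v"

definition strictly_convex_on :: "'a::real_vector set \<Rightarrow> ('a \<Rightarrow> real) \<Rightarrow> bool" where
  "strictly_convex_on S f \<longleftrightarrow> convex S \<and>
     (\<forall>x\<in>S. \<forall>y\<in>S. \<forall>r>0. \<forall>s>0. x \<noteq> y \<and> r + s = 1 \<longrightarrow>
        f (r *\<^sub>R x + s *\<^sub>R y) < r * f x + s * f y)"

definition strictly_concave_on :: "'a::real_vector set \<Rightarrow> ('a \<Rightarrow> real) \<Rightarrow> bool" where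
  "strictly_concave_on S f \<longleftrightarrow> strictly_convex_on S (\<lambda>x. - f x)"

definition positive_definite :: "real^'m^'m \<Rightarrow> bool" where
  "positive_definite A \<longleftrightarrow> (\<forall>z. z \<noteq> 0 \<longrightarrow> z \<bullet> (A *v z) > 0)"

definition block_matrix ::
    "real^'n^'n \<Rightarrow> real^'n^'n \<Rightarrow> real^'n^'n \<Rightarrow> real^'n^'n \<Rightarrow> real^('n + 'n)^('n + 'n)" where
  "block_matrix A B C D = (\<chi> r c.
     (case r of
        Inl i \<Rightarrow> (case c of Inl j \<Rightarrow> A $ i $ j | Inr j \<Rightarrow> B $ i $ j)
      | Inr i \<Rightarrow> (case c of Inl j \<Rightarrow> C $ i $ j | Inr j \<Rightarrow> D $ i $ j)))"

locale chns_coefficients =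
  fixes \<gamma> :: real
    and \<Psi> \<eta> :: "real \<Rightarrow> real \<Rightarrow> real"
    and L11 L12 L22 :: "real \<Rightarrow> real^'n \<Rightarrow> real \<Rightarrow> real^'n^'n"
  assumes gamma_pos: "\<gamma> > 0"
    and eta_pos: "\<And>z \<tau>. \<tau> > 0 \<Longrightarrow> \<eta> z \<tau> > 0"
    and eta_C1: "Ck_on 1 (\<lambda>(z, \<tau>). \<eta> z \<tau>) (UNIV \<times> {0<..})"
    and L_sym: "\<And>z g \<tau>. \<tau> > 0 \<Longrightarrow>
          (let L = block_matrix (L11 z g \<tau>) (- L12 z g \<tau>) (- L12 z g \<tau>) (L22 z g \<tau>)
           in transpose L = L \<and> positive_definite L)"
    and L12_sym: "\<And>z g \<tau>. \<tau> > 0 \<Longrightarrow> transpose (L12 z g \<tau>) = L12 z g \<tau>"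
    and L_C1: "Ck_on 1 (\<lambda>(z, g, \<tau>).
          block_matrix (L11 z g \<tau>) (- L12 z g \<tau>) (- L12 z g \<tau>) (L22 z g \<tau>))
          (UNIV \<times> UNIV \<times> {0<..})"
    and Psi_C2: "Ck_on 2 (\<lambda>(z, \<tau>). \<Psi> z \<tau>) (UNIV \<times> {0<..})"
    and Psi_concave: "\<And>z. concave_on {0<..} (\<Psi> z)"
    and Psi_blowup: "\<And>z. filterlim (\<lambda>\<tau>. \<bar>\<Psi> z \<tau>\<bar>) at_top (at_right 0)"
    and Psi_split: "\<exists>\<Psi>vex \<Psi>cav. \<forall>\<tau>>0.
          (\<forall>z. \<Psi> z \<tau> = \<Psi>vex z \<tau> + \<Psi>cav z \<tau>) \<and>
          strictly_convex_on UNIV (\<lambda>z. \<Psi>vex z \<tau>) \<and>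
          strictly_concave_on UNIV (\<lambda>z. \<Psi>cav z \<tau>)"

definition helmholtz ::
    "real \<Rightarrow> (real \<Rightarrow> real \<Rightarrow> real) \<Rightarrow> (real \<Rightarrow> real^'n \<Rightarrow> real) \<Rightarrow> (real \<Rightarrow> real^'n \<Rightarrow> real)
     \<Rightarrow> real \<Rightarrow> real^'n \<Rightarrow> real" where
  "helmholtz \<gamma> \<Psi> \<phi> \<theta> t x = \<Psi> (\<phi> t x) (\<theta> t x) + \<gamma>/2 * (norm (grad (\<phi> t) x))\<^sup>2"

definition dphi_Psi ::
    "(real \<Rightarrow> real \<Rightarrow> real) \<Rightarrow> (real \<Rightarrow> real^'n \<Rightarrow> real) \<Rightarrow> (real \<Rightarrow> real^'n \<Rightarrow> real)
     \<Rightarrow> real \<Rightarrow> real^'n \<Rightarrow> real" where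
  "dphi_Psi \<Psi> \<phi> \<theta> t x = deriv (\<lambda>z. \<Psi> z (\<theta> t x)) (\<phi> t x)"

text \<open>As \<open>\<theta>\<close> is the inverse temperature, the internal energy is \<open>\<partial>\<^sub>\<theta>\<Psi>\<close>.\<close>

definition internal_energy ::
    "(real \<Rightarrow> real \<Rightarrow> real) \<Rightarrow> (real \<Rightarrow> real^'n \<Rightarrow> real) \<Rightarrow> (real \<Rightarrow> real^'n \<Rightarrow> real)
     \<Rightarrow> real \<Rightarrow> real^'n \<Rightarrow> real" where
  "internal_energy \<Psi> \<phi> \<theta> t x = deriv (\<lambda>\<tau>. \<Psi> (\<phi> t x) \<tau>) (\<theta> t x)"

definition entropy ::
    "real \<Rightarrow> (real \<Rightarrow> real \<Rightarrow> real) \<Rightarrow> (real \<Rightarrow> real^'n \<Rightarrow> real) \<Rightarrow> (real \<Rightarrow> real^'n \<Rightarrow> real)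
     \<Rightarrow> real \<Rightarrow> real^'n \<Rightarrow> real" where
  "entropy \<gamma> \<Psi> \<phi> \<theta> t x = \<theta> t x * internal_energy \<Psi> \<phi> \<theta> t x - helmholtz \<gamma> \<Psi> \<phi> \<theta> t x"

definition korteweg ::
    "real \<Rightarrow> (real \<Rightarrow> real^'n \<Rightarrow> real) \<Rightarrow> (real \<Rightarrow> real^'n \<Rightarrow> real) \<Rightarrow> real \<Rightarrow> real^'n \<Rightarrow> real^'n^'n" where
  "korteweg \<gamma> \<phi> \<theta> t x = (\<gamma> / \<theta> t x) *\<^sub>R (\<chi> i j. grad (\<phi> t) x $ i * grad (\<phi> t) x $ j)"

definition viscosity ::
    "(real \<Rightarrow> real \<Rightarrow> real) \<Rightarrow> (real \<Rightarrow> real^'n \<Rightarrow> real) \<Rightarrow> (real \<Rightarrow> real^'n \<Rightarrow> real)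
     \<Rightarrow> real \<Rightarrow> real^'n \<Rightarrow> real" where
  "viscosity \<eta> \<phi> \<theta> t x = \<eta> (\<phi> t x) (\<theta> t x)"

definition mobility ::
    "(real \<Rightarrow> real^'n \<Rightarrow> real \<Rightarrow> real^'n^'n) \<Rightarrow> (real \<Rightarrow> real^'n \<Rightarrow> real) \<Rightarrow> (real \<Rightarrow> real^'n \<Rightarrow> real)
     \<Rightarrow> real \<Rightarrow> real^'n \<Rightarrow> real^'n^'n" where
  "mobility L \<phi> \<theta> t x = L (\<phi> t x) (grad (\<phi> t) x) (\<theta> t x)"

locale chns_classical_solution =
  fixes a :: "real^'n" and l T :: real
    and \<gamma> :: real
    and \<Psi> \<eta> :: "real \<Rightarrow> real \<Rightarrow> real"
    and L11 L12 L22 :: "real \<Rightarrow> real^'n \<Rightarrow> real \<Rightarrow> real^'n^'n"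
    and \<phi> \<mu> \<theta> :: "real \<Rightarrow> real^'n \<Rightarrow> real"
    and u :: "real \<Rightarrow> real^'n \<Rightarrow> real^'n"
    and p :: "real \<Rightarrow> real^'n \<Rightarrow> real"
  assumes phi_reg: "C1_Ck l T 4 \<phi>"
    and mu_reg: "C0_Ck l T 2 \<mu>"
    and theta_reg: "C1_Ck l T 2 \<theta>"
    and u_reg: "C1_Ck l T 2 u"
    and p_reg: "C0_Ck l T 4 p"
    and theta_pos: "\<And>t x. t \<in> {0<..T} \<Longrightarrow> x \<in> cube a l \<Longrightarrow> \<theta> t x > 0"
    and phase_eq: "\<And>t x. t \<in> {0<..T} \<Longrightarrow> x \<in> cube a l \<Longrightarrow>
          time_deriv T \<phi> t x + u t x \<bullet> grad (\<phi> t) x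
          - divergence (\<lambda>y. mobility L11 \<phi> \<theta> t y *v grad (\<mu> t) y
                          - mobility L12 \<phi> \<theta> t y *v grad (\<theta> t) y) x = 0"
    and potential_eq: "\<And>t x. t \<in> {0<..T} \<Longrightarrow> x \<in> cube a l \<Longrightarrow>
          \<mu> t x = - \<gamma> * laplacian (\<phi> t) x + dphi_Psi \<Psi> \<phi> \<theta> t x"
    and energy_eq: "\<And>t x. t \<in> {0<..T} \<Longrightarrow> x \<in> cube a l \<Longrightarrow>
          time_deriv T (internal_energy \<Psi> \<phi> \<theta>) t x + u t x \<bullet> grad (internal_energy \<Psi> \<phi> \<theta> t) x
          - divergence (\<lambda>y. mobility L12 \<phi> \<theta> t y *v grad (\<mu> t) y
                          - mobility L22 \<phi> \<theta> t y *v grad (\<theta> t) y) x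
          - (viscosity \<eta> \<phi> \<theta> t x *\<^sub>R sym_grad (u t) x - korteweg \<gamma> \<phi> \<theta> t x)
              \<bullet> jacobian (u t) (at x) = 0"
    and momentum_eq: "\<And>t x. t \<in> {0<..T} \<Longrightarrow> x \<in> cube a l \<Longrightarrow>
          time_deriv T u t x + jacobian (u t) (at x) *v u t x
          - matrix_divergence (\<lambda>y. viscosity \<eta> \<phi> \<theta> t y *\<^sub>R sym_grad (u t) y
                                 - p t y *\<^sub>R mat 1 - korteweg \<gamma> \<phi> \<theta> t y) x = 0"
    and incompressible: "\<And>t x. t \<in> {0<..T} \<Longrightarrow> x \<in> cube a l \<Longrightarrow> divergence (u t) x = 0"

end

theory Submission
  imports Defs
begin

text \<open>
  After multiplication with a test function, each of the strong equations has an integrand that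
  differs from the integrand of the weak equation by the divergence of a periodic \<open>C\<^sup>1\<close> vector field.
  Such a divergence integrates to zero, because the integral over a period cell does not change under
  translations. For the energy and the momentum equation this rests on the pointwise identity
  \<open>\<nabla>e + (\<phi>/\<theta>)\<nabla>\<mu> - \<sigma>\<nabla>\<theta>/\<theta> - (1/\<theta>)\<nabla>(s + \<phi>\<mu>) = div \<sigma>\<close>, which follows from the definition of the
  entropy, the equation for \<open>\<mu>\<close> and the symmetry of the Hessian of \<open>\<phi>\<close>. The time derivatives are
  continuous in space since the strong equations express them through continuous functions.
\<close>

section \<open>Continuously differentiable functions\<close>

text \<open>Write r = s + \<phi>\<mu>. Since -(1/\<theta>)\<nabla>r = -\<nabla>(r/\<theta>) +
  r\<nabla>(1/\<theta>), the pointwise identity splits div \<sigma> into the gradient of e -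
  r/\<theta> and the force (\<phi>/\<theta>)\<nabla>\<mu> + r\<nabla>(1/\<theta>) -
  \<sigma>\<nabla>\<theta>/\<theta>. In the momentum equation the gradient part joins the pressure;
  this is the origin of \<pi>. In the energy equation, \<sigma>:\<nabla>u = div(\<sigma>u) - u . div
  \<sigma>, and the last term absorbs u . \<nabla>e, leaving (1/\<theta>) u . \<nabla>r. Tested with
  w and integrated by parts against the solenoidal u, it puts the gradient on the quotient
  w/\<theta>. The internal energy is itself a derivative of \<Psi>, which is assumed C2, so only C1
  regularity can be expected of the fluxes; the calculus is built for C1 fields. The equations are
  known on the closed cube, whereas the derivatives at a point are taken in full neighbourhoods.
  Fields and fluxes are therefore periodic functions on the whole space, while the equations are
  invoked inside the cube.\<close>

definition C1_on :: "'a::euclidean_space set \<Rightarrow> ('a \<Rightarrow> 'b::real_normed_vector) \<Rightarrow> bool" where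
  "C1_on S f \<longleftrightarrow> (\<forall>x\<in>S. f differentiable (at x)) \<and>
     (\<forall>h. continuous_on S (\<lambda>x. frechet_derivative f (at x) h))"

lemma frechet_derivative_Basis_sum:
  fixes f :: "'a::euclidean_space \<Rightarrow> 'b::real_normed_vector"
  assumes "f differentiable (at x)"
  shows "frechet_derivative f (at x) h = (\<Sum>b\<in>Basis. (h \<bullet> b) *\<^sub>R frechet_derivative f (at x) b)"
proof -
  interpret linear "frechet_derivative f (at x)"
    using assms by (rule linear_frechet_derivative)
  have "frechet_derivative f (at x) h = frechet_derivative f (at x) (\<Sum>b\<in>Basis. (h \<bullet> b) *\<^sub>R b)"
    by (simp add: euclidean_representation)
  then show ?thesis
    by (simp add: sum scaleR)
qed

lemma C1_on_Basis_iff: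
  "C1_on S f \<longleftrightarrow> (\<forall>x\<in>S. f differentiable (at x)) \<and>
     (\<forall>b\<in>Basis. continuous_on S (\<lambda>x. frechet_derivative f (at x) b))"
proof (intro iffI conjI)
  assume *: "(\<forall>x\<in>S. f differentiable (at x)) \<and>
     (\<forall>b\<in>Basis. continuous_on S (\<lambda>x. frechet_derivative f (at x) b))"
  have "continuous_on S (\<lambda>x. frechet_derivative f (at x) h)" for h
  proof -
    have "continuous_on S (\<lambda>x. \<Sum>b\<in>Basis. (h \<bullet> b) *\<^sub>R frechet_derivative f (at x) b)"
      using * by (intro continuous_intros) auto
    then show ?thesis
      by (rule continuous_on_eq) (use * frechet_derivative_Basis_sum[of f _ h] in auto)
  qed
  then show "C1_on S f"
    using * by (simp add: C1_on_def)
qed (auto simp: C1_on_def)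

lemma C1_onD:
  assumes "C1_on S f"
  shows "x \<in> S \<Longrightarrow> f differentiable (at x)"
    and "x \<in> S \<Longrightarrow> (f has_derivative frechet_derivative f (at x)) (at x)"
    and "continuous_on S (\<lambda>x. frechet_derivative f (at x) h)"
    and "continuous_on S f"
proof -
  show *: "f differentiable (at x)" if "x \<in> S" for x
    using assms that by (simp add: C1_on_def)
  then show "(f has_derivative frechet_derivative f (at x)) (at x)" if "x \<in> S" for x
    using that by (simp add: frechet_derivative_works)
  show "continuous_on S (\<lambda>x. frechet_derivative f (at x) h)" for h
    using assms by (simp add: C1_on_def)
  show "continuous_on S f"
    using * by (intro differentiable_imp_continuous_on) (simp add: differentiable_on_def differentiable_at_withinI)
qed

text \<open>For order 1 only the empty list and the singleton lists of basis vectors occur, and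
  continuity of \<open>f\<close> follows from differentiability. \<open>C1_on\<close> asks for
  continuity in every fixed direction instead of basis directions, which makes the product and
  composition rules independent of bases.\<close>

lemma Ck_on_1_iff: "Ck_on 1 f S \<longleftrightarrow> C1_on S f"
proof -
  have 0: "set bs \<subseteq> Basis \<and> length bs < 1 \<longleftrightarrow> bs = []" for bs :: "'a list"
    by auto
  have 1: "set bs \<subseteq> Basis \<and> length bs \<le> 1 \<longleftrightarrow> bs = [] \<or> (\<exists>b\<in>Basis. bs = [b])" for bs :: "'a list"
    by (cases bs) auto
  have 2: "(\<forall>bs. bs = [] \<or> (\<exists>b\<in>Basis. bs = [b]) \<longrightarrow> P bs) \<longleftrightarrow> P [] \<and> (\<forall>b\<in>Basis. P [b])"
    for P :: "'a list \<Rightarrow> bool"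
    by blast
  have "Ck_on 1 f S \<longleftrightarrow> C1_on S f \<and> continuous_on S f"
    unfolding Ck_on_def 0 1 2 C1_on_Basis_iff iter_deriv.simps simp_thms
    by (simp only: conj_ac)
  then show ?thesis
    using C1_onD(4) by blast
qed

lemma C1_onI:
  assumes "\<And>x. x \<in> S \<Longrightarrow> (f has_derivative f' x) (at x)"
    and "\<And>h. continuous_on S (\<lambda>x. f' x h)"
  shows "C1_on S f"
  unfolding C1_on_def
proof (intro conjI ballI allI)
  show "f differentiable (at x)" if "x \<in> S" for x
    using assms(1)[OF that] by (rule differentiableI)
  show "continuous_on S (\<lambda>x. frechet_derivative f (at x) h)" for h
    using assms(2)[of h] by (rule continuous_on_eq) (simp add: frechet_derivative_at[OF assms(1)])
qed

lemma C1_on_subset: "C1_on S f \<Longrightarrow> T \<subseteq> S \<Longrightarrow> C1_on T f"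
  by (auto simp: C1_on_def intro: continuous_on_subset)

lemma C1_on_const: "C1_on S (\<lambda>_. c)"
  by (rule C1_onI[where f' = "\<lambda>_ _. 0"]) auto

lemma C1_on_linear:
  assumes "bounded_linear g" "C1_on S f"
  shows "C1_on S (\<lambda>x. g (f x))"
proof (rule C1_onI)
  show "((\<lambda>x. g (f x)) has_derivative (\<lambda>h. g (frechet_derivative f (at x) h))) (at x)"
    if "x \<in> S" for x
    using that by (intro bounded_linear.has_derivative[OF assms(1)] C1_onD(2)[OF assms(2)])
  show "continuous_on S (\<lambda>x. g (frechet_derivative f (at x) h))" for h
    by (intro bounded_linear.continuous_on[OF assms(1)] C1_onD(3)[OF assms(2)])
qed

lemma C1_on_bilinear:
  assumes "bounded_bilinear B" "C1_on S f" "C1_on S g"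
  shows "C1_on S (\<lambda>x. B (f x) (g x))"
proof (rule C1_onI)
  show "((\<lambda>x. B (f x) (g x)) has_derivative
      (\<lambda>h. B (f x) (frechet_derivative g (at x) h) + B (frechet_derivative f (at x) h) (g x))) (at x)"
    if "x \<in> S" for x
    using that by (intro bounded_bilinear.FDERIV[OF assms(1)] C1_onD(2)[OF assms(2)] C1_onD(2)[OF assms(3)])
  show "continuous_on S (\<lambda>x. B (f x) (frechet_derivative g (at x) h)
      + B (frechet_derivative f (at x) h) (g x))" for h
    by (intro continuous_on_add bounded_bilinear.continuous_on[OF assms(1)]
        C1_onD(3,4)[OF assms(2)] C1_onD(3,4)[OF assms(3)])
qed

lemmas C1_on_nth = C1_on_linear[OF bounded_linear_vec_nth]
lemmas C1_on_minus = C1_on_linear[OF bounded_linear_minus[OF bounded_linear_ident]]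
lemmas C1_on_scaleR = C1_on_bilinear[OF bounded_bilinear_scaleR]
lemmas C1_on_mult = C1_on_bilinear[OF bounded_bilinear_mult]
lemmas C1_on_inner = C1_on_bilinear[OF bounded_bilinear_inner]

lemma C1_on_add:
  assumes "C1_on S f" "C1_on S g"
  shows "C1_on S (\<lambda>x. f x + g x)"
proof (rule C1_onI)
  show "((\<lambda>x. f x + g x) has_derivative
      (\<lambda>h. frechet_derivative f (at x) h + frechet_derivative g (at x) h)) (at x)" if "x \<in> S" for x
    using assms that by (intro has_derivative_add C1_onD(2))
  show "continuous_on S (\<lambda>x. frechet_derivative f (at x) h + frechet_derivative g (at x) h)" for h
    using assms by (intro continuous_on_add C1_onD(3))
qed

lemma C1_on_diff:
  assumes "C1_on S f" "C1_on S g"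
  shows "C1_on S (\<lambda>x. f x - g x)"
  using C1_on_add[OF assms(1) C1_on_minus[OF assms(2)]] by simp

lemma C1_on_Pair:
  assumes "C1_on S f" "C1_on S g"
  shows "C1_on S (\<lambda>x. (f x, g x))"
proof (rule C1_onI)
  show "((\<lambda>x. (f x, g x)) has_derivative
      (\<lambda>h. (frechet_derivative f (at x) h, frechet_derivative g (at x) h))) (at x)" if "x \<in> S" for x
    using assms that by (intro has_derivative_Pair C1_onD(2))
  show "continuous_on S (\<lambda>x. (frechet_derivative f (at x) h, frechet_derivative g (at x) h))" for h
    using assms by (intro continuous_on_Pair C1_onD(3))
qed

lemma C1_on_sum:
  assumes "\<And>i. i \<in> I \<Longrightarrow> C1_on S (f i)"
  shows "C1_on S (\<lambda>x. \<Sum>i\<in>I. f i x)"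
  using assms by (induction I rule: infinite_finite_induct) (auto intro: C1_on_const C1_on_add)

lemma C1_on_compose:
  fixes f :: "'a::euclidean_space \<Rightarrow> 'b::euclidean_space" and g :: "'b \<Rightarrow> 'c::real_normed_vector"
  assumes g: "C1_on T g" and f: "C1_on S f" and sub: "\<And>x. x \<in> S \<Longrightarrow> f x \<in> T"
  shows "C1_on S (\<lambda>x. g (f x))"
proof (rule C1_onI)
  \<comment> \<open>In the chain rule the direction fed to the derivative of \<open>g\<close> varies
    with \<open>x\<close>, but \<open>C1_on\<close> gives continuity for fixed directions only.
    Expanding in the basis moves the variation into scalar factors.\<close>
  show "((\<lambda>x. g (f x)) has_derivative
      (\<lambda>h. \<Sum>b\<in>Basis. (frechet_derivative f (at x) h \<bullet> b) *\<^sub>R frechet_derivative g (at (f x)) b)) (at x)"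
    if x: "x \<in> S" for x
    using has_derivative_compose[OF C1_onD(2)[OF f x] C1_onD(2)[OF g sub[OF x]]]
    by (subst (asm) frechet_derivative_Basis_sum[OF C1_onD(1)[OF g sub[OF x]]])
  show "continuous_on S
      (\<lambda>x. \<Sum>b\<in>Basis. (frechet_derivative f (at x) h \<bullet> b) *\<^sub>R frechet_derivative g (at (f x)) b)" for h
    using sub
    by (intro continuous_intros C1_onD(3)[OF f]
        continuous_on_compose2[OF C1_onD(3)[OF g] C1_onD(4)[OF f]]) auto
qed

lemma has_derivative_vec:
  fixes f :: "'a::euclidean_space \<Rightarrow> 'n::finite \<Rightarrow> 'b::real_normed_vector"
  assumes "\<And>i. ((\<lambda>x. f x i) has_derivative f' i) (at x)"
  shows "((\<lambda>x. \<chi> i. f x i) has_derivative (\<lambda>h. \<chi> i. f' i h)) (at x)"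
  unfolding has_derivative_at
proof
  have lin: "linear (f' i)" for i
    using assms by (rule has_derivative_linear)
  then have "linear (\<lambda>h. \<chi> i. f' i h)"
    by (intro linearI) (simp_all add: vec_eq_iff linear_add linear_cmul)
  then show "bounded_linear (\<lambda>h. \<chi> i. f' i h)"
    by (rule linear_conv_bounded_linear[THEN iffD1])
  \<comment> \<open>Dividing the remainder itself, not its norm, by \<open>norm h\<close> gives a
    vector whose limit can be taken coordinate by coordinate; the norm is put back at the
    end.\<close>
  have "((\<lambda>h. (1 / norm h) *\<^sub>R (f (x + h) i - f x i - f' i h)) \<longlongrightarrow> 0) (at 0)" for i
    using assms[of i, unfolded has_derivative_at]
    by (subst tendsto_norm_zero_iff[symmetric]) (simp add: divide_inverse_commute)
  then have "((\<lambda>h. (1 / norm h) *\<^sub>R ((\<chi> i. f (x + h) i) - (\<chi> i. f x i) - (\<chi> i. f' i h))) \<longlongrightarrow> 0) (at 0)"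
    by (intro vec_tendstoI) simp
  then show "(\<lambda>h. norm ((\<chi> i. f (x + h) i) - (\<chi> i. f x i) - (\<chi> i. f' i h)) / norm h) \<midarrow>0\<rightarrow> 0"
    by (subst (asm) tendsto_norm_zero_iff[symmetric]) (simp add: divide_inverse_commute)
qed

lemma C1_on_vec:
  fixes f :: "'a::euclidean_space \<Rightarrow> 'n::finite \<Rightarrow> 'b::real_normed_vector"
  assumes "\<And>i. C1_on S (\<lambda>x. f x i)"
  shows "C1_on S (\<lambda>x. \<chi> i. f x i)"
proof (rule C1_onI)
  show "((\<lambda>x. \<chi> i. f x i) has_derivative (\<lambda>h. \<chi> i. frechet_derivative (\<lambda>x. f x i) (at x) h)) (at x)"
    if x: "x \<in> S" for x
    using C1_onD(2)[OF assms x] by (rule has_derivative_vec)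
  show "continuous_on S (\<lambda>x. \<chi> i. frechet_derivative (\<lambda>x. f x i) (at x) h)" for h
    using assms by (intro continuous_on_vec_lambda C1_onD(3))
qed

lemma C1_on_inverse:
  fixes f :: "'a::euclidean_space \<Rightarrow> real"
  assumes "C1_on S f" "\<And>x. x \<in> S \<Longrightarrow> f x \<noteq> 0"
  shows "C1_on S (\<lambda>x. inverse (f x))"
proof (rule C1_onI)
  show "((\<lambda>x. inverse (f x)) has_derivative
     (\<lambda>h. - (inverse (f x) * frechet_derivative f (at x) h * inverse (f x)))) (at x)" if "x \<in> S" for x
    using Deriv.has_derivative_inverse[OF assms(2)[OF that] C1_onD(2)[OF assms(1) that]] by simp
  show "continuous_on S (\<lambda>x. - (inverse (f x) * frechet_derivative f (at x) h * inverse (f x)))" for h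
    using assms by (intro continuous_intros C1_onD(3)[OF assms(1)] C1_onD(4)[OF assms(1)]) auto
qed

lemma C1_on_divide:
  fixes f g :: "'a::euclidean_space \<Rightarrow> real"
  assumes "C1_on S f" "C1_on S g" "\<And>x. x \<in> S \<Longrightarrow> g x \<noteq> 0"
  shows "C1_on S (\<lambda>x. f x / g x)"
  unfolding divide_inverse using assms by (intro C1_on_mult C1_on_inverse)

lemma C1_on_matrix_vector_mult:
  fixes A :: "'a::euclidean_space \<Rightarrow> real^'n^'m"
  assumes "C1_on S A" "C1_on S v"
  shows "C1_on S (\<lambda>x. A x *v v x)"
  unfolding matrix_vector_mult_def
  using assms by (intro C1_on_vec C1_on_sum C1_on_mult C1_on_nth)

section \<open>Symmetry of mixed second derivatives\<close>

text \<open>The mean value theorem twice: along \<open>i\<close> for the difference of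
  \<open>f\<close> on two parallel lines offset by \<open>r *\<^sub>R j\<close>, then along
  \<open>j\<close> for the derivative of \<open>f\<close> in direction \<open>i\<close>.\<close>

lemma second_difference_mean_value:
  fixes f :: "'a::euclidean_space \<Rightarrow> real"
  assumes f: "\<And>y. f differentiable (at y)"
    and fi: "\<And>y. (\<lambda>z. frechet_derivative f (at z) i) differentiable (at y)"
    and "0 < r"
  obtains s t where "0 < s" "s < r" "0 < t" "t < r"
    and "f (x + r *\<^sub>R i + r *\<^sub>R j) - f (x + r *\<^sub>R i) - f (x + r *\<^sub>R j) + f x
      = r\<^sup>2 * frechet_derivative (\<lambda>y. frechet_derivative f (at y) i) (at (x + s *\<^sub>R i + t *\<^sub>R j)) j"
proof -
  define g where "g = (\<lambda>y. frechet_derivative f (at y) i)"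
  have line: "((\<lambda>s. k (c + s *\<^sub>R d)) has_real_derivative frechet_derivative k (at (c + s *\<^sub>R d)) d) (at s)"
    if "\<And>y. k differentiable (at y)" for k :: "'a \<Rightarrow> real" and c d s
  proof -
    have "((\<lambda>s. k (c + s *\<^sub>R d)) has_derivative (\<lambda>h. frechet_derivative k (at (c + s *\<^sub>R d)) (h *\<^sub>R d))) (at s)"
      by (rule has_derivative_compose[OF _ that[unfolded frechet_derivative_works]])
        (auto intro!: derivative_eq_intros)
    then show ?thesis
      by (simp add: has_field_derivative_def linear_cmul[OF linear_frechet_derivative[OF that]] mult_commute_abs)
  qed
  have "((\<lambda>s. f (x + r *\<^sub>R j + s *\<^sub>R i) - f (x + s *\<^sub>R i)) has_real_derivative
      g (x + r *\<^sub>R j + s *\<^sub>R i) - g (x + s *\<^sub>R i)) (at s)" for s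
    unfolding g_def by (intro DERIV_diff line f)
  from MVT2[OF \<open>0 < r\<close> this] obtain s where s: "0 < s" "s < r"
    "f (x + r *\<^sub>R j + r *\<^sub>R i) - f (x + r *\<^sub>R i) - (f (x + r *\<^sub>R j) - f x)
      = r * (g (x + r *\<^sub>R j + s *\<^sub>R i) - g (x + s *\<^sub>R i))"
    by auto
  have "((\<lambda>t. g (x + s *\<^sub>R i + t *\<^sub>R j)) has_real_derivative
      frechet_derivative g (at (x + s *\<^sub>R i + t *\<^sub>R j)) j) (at t)" for t
    by (intro line) (use fi in \<open>simp add: g_def\<close>)
  from MVT2[OF \<open>0 < r\<close> this] obtain t where t: "0 < t" "t < r"
    "g (x + s *\<^sub>R i + r *\<^sub>R j) - g (x + s *\<^sub>R i)
      = r * frechet_derivative g (at (x + s *\<^sub>R i + t *\<^sub>R j)) j"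
    by auto
  show thesis
    by (rule that[OF s(1,2) t(1,2)]) (use s(3) t(3) in \<open>simp add: g_def algebra_simps power2_eq_square\<close>)
qed

text \<open>The second difference is symmetric in \<open>i\<close> and \<open>j\<close>. Evaluating
  it in both orders gives, for each r > 0, two points within r(|i| + |j|) of \<open>x\<close> at
  which the two mixed derivatives take the same value. Continuity at \<open>x\<close> finishes as r
  tends to 0.\<close>

lemma frechet_derivative_commute:
  fixes f :: "'a::euclidean_space \<Rightarrow> real"
  assumes f: "\<And>y. f differentiable (at y)"
    and fi: "C1_on UNIV (\<lambda>y. frechet_derivative f (at y) i)"
    and fj: "C1_on UNIV (\<lambda>y. frechet_derivative f (at y) j)"
  shows "frechet_derivative (\<lambda>y. frechet_derivative f (at y) i) (at x) j
       = frechet_derivative (\<lambda>y. frechet_derivative f (at y) j) (at x) i"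
    (is "?g x = ?h x")
proof -
  have "\<exists>y z. y \<in> cball x (r * (norm i + norm j)) \<and> z \<in> cball x (r * (norm i + norm j)) \<and> ?g y = ?h z"
    if r: "r > 0" for r
  proof -
    obtain s t where st: "0 < s" "s < r" "0 < t" "t < r"
      "f (x + r *\<^sub>R i + r *\<^sub>R j) - f (x + r *\<^sub>R i) - f (x + r *\<^sub>R j) + f x = r\<^sup>2 * ?g (x + s *\<^sub>R i + t *\<^sub>R j)"
      using second_difference_mean_value[OF f C1_onD(1)[OF fi UNIV_I] r] by metis
    obtain s' t' where st': "0 < s'" "s' < r" "0 < t'" "t' < r"
      "f (x + r *\<^sub>R j + r *\<^sub>R i) - f (x + r *\<^sub>R j) - f (x + r *\<^sub>R i) + f x = r\<^sup>2 * ?h (x + s' *\<^sub>R j + t' *\<^sub>R i)"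
      using second_difference_mean_value[OF f C1_onD(1)[OF fj UNIV_I] r] by metis
    have near: "x + c *\<^sub>R v + d *\<^sub>R w \<in> cball x (r * (norm v + norm w))"
      if "0 < c" "c < r" "0 < d" "d < r" for c d and v w :: 'a
    proof -
      have "norm (c *\<^sub>R v + d *\<^sub>R w) \<le> c * norm v + d * norm w"
        using that by (intro norm_triangle_le) simp
      also have "\<dots> \<le> r * norm v + r * norm w"
        using that by (intro add_mono mult_right_mono) auto
      finally show ?thesis
        by (simp add: dist_norm norm_minus_commute algebra_simps)
    qed
    have "r\<^sup>2 * ?g (x + s *\<^sub>R i + t *\<^sub>R j) = r\<^sup>2 * ?h (x + s' *\<^sub>R j + t' *\<^sub>R i)"
      using st(5) st'(5) by (simp add: algebra_simps)
    then have "?g (x + s *\<^sub>R i + t *\<^sub>R j) = ?h (x + s' *\<^sub>R j + t' *\<^sub>R i)"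
      using r by simp
    then show ?thesis
      using near[OF st(1-4), of i j] near[OF st'(1-4), of j i] by (metis add.commute)
  qed
  then have "\<forall>n. \<exists>y z. y \<in> cball x (inverse (real (Suc n)) * (norm i + norm j)) \<and>
      z \<in> cball x (inverse (real (Suc n)) * (norm i + norm j)) \<and> ?g y = ?h z"
    by (auto simp del: mem_cball of_nat_Suc)
  then obtain y z where yz: "\<And>n. y n \<in> cball x (inverse (real (Suc n)) * (norm i + norm j))"
      "\<And>n. z n \<in> cball x (inverse (real (Suc n)) * (norm i + norm j))" "\<And>n. ?g (y n) = ?h (z n)"
    by metis
  have lim: "w \<longlonglongrightarrow> x" if "\<And>n. w n \<in> cball x (inverse (real (Suc n)) * (norm i + norm j))" for w
  proof -
    have "(\<lambda>n. inverse (real (Suc n)) * (norm i + norm j)) \<longlonglongrightarrow> 0 * (norm i + norm j)"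
      by (intro tendsto_mult tendsto_const LIMSEQ_inverse_real_of_nat)
    then have "(\<lambda>n. inverse (real (Suc n)) * (norm i + norm j)) \<longlonglongrightarrow> 0" by simp
    moreover have "\<forall>n. norm (dist (w n) x) \<le> inverse (real (Suc n)) * (norm i + norm j)"
      using that unfolding mem_cball by (simp only: real_norm_def abs_of_nonneg zero_le_dist dist_commute simp_thms)
    ultimately have "(\<lambda>n. dist (w n) x) \<longlonglongrightarrow> 0"
      by (rule Lim_null_comparison[OF always_eventually, rotated])
    then show ?thesis
      by (rule tendsto_dist_iff[THEN iffD2])
  qed
  have cont: "isCont ?g x" "isCont ?h x"
    using C1_onD(3)[OF fi] C1_onD(3)[OF fj] by (auto simp: continuous_on_eq_continuous_at)
  have "(\<lambda>n. ?g (y n)) \<longlonglongrightarrow> ?g x" "(\<lambda>n. ?g (y n)) \<longlonglongrightarrow> ?h x"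
    using isCont_tendsto_compose[OF cont(1) lim[OF yz(1)]] isCont_tendsto_compose[OF cont(2) lim[OF yz(2)]]
    by (simp_all add: yz(3))
  then show ?thesis
    by (rule LIMSEQ_unique)
qed

section \<open>The divergence theorem on the torus\<close>

lemma periodicD: "periodic l f \<Longrightarrow> f (x + l *\<^sub>R axis i 1) = f x"
  by (simp add: periodic_def)

lemma periodic_add_int_multiple:
  assumes "periodic l f"
  shows "f (x + (of_int k * l) *\<^sub>R axis i 1) = f x"
proof (induction k rule: int_induct[where k = 0])
  case (step1 k)
  have "f (x + (of_int (k + 1) * l) *\<^sub>R axis i 1) = f (x + (of_int k * l) *\<^sub>R axis i 1 + l *\<^sub>R axis i 1)"
    by (simp add: algebra_simps)
  then show ?case
    using step1 by (simp add: periodicD[OF assms])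
next
  case (step2 k)
  have "f (x + (of_int k * l) *\<^sub>R axis i 1) = f (x + (of_int (k - 1) * l) *\<^sub>R axis i 1 + l *\<^sub>R axis i 1)"
    by (simp add: algebra_simps)
  then show ?case
    using step2 by (simp add: periodicD[OF assms])
qed simp

text \<open>Transfers facts known only on the closed cube, such as positivity of the inverse
  temperature, to the whole space.\<close>

lemma periodic_representative:
  fixes f :: "real^'n \<Rightarrow> 'b"
  assumes "periodic l f" "l > 0"
  obtains y where "y \<in> cube a l" "f y = f x"
proof -
  \<comment> \<open>With minus the floor, coordinate \<open>i\<close> lands at a_i plus l times the
    fractional part of (x_i - a_i)/l.\<close>
  define k where "k i = - \<lfloor>(x $ i - a $ i) / l\<rfloor>" for i
  \<comment> \<open>The coordinates are shifted one at a time, by induction over the set of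
    directions already treated.\<close>
  have "f (x + (\<Sum>i\<in>I. (of_int (k i) * l) *\<^sub>R axis i 1)) = f x" if "finite I" for I
    using that
  proof induction
    case (insert i I)
    have "f (x + (\<Sum>i\<in>insert i I. (of_int (k i) * l) *\<^sub>R axis i 1))
        = f (x + (\<Sum>i\<in>I. (of_int (k i) * l) *\<^sub>R axis i 1) + (of_int (k i) * l) *\<^sub>R axis i 1)"
      using insert by (simp add: algebra_simps)
    then show ?case
      using insert periodic_add_int_multiple[OF assms(1)] by metis
  qed simp
  then have "f (x + (\<Sum>i\<in>UNIV. (of_int (k i) * l) *\<^sub>R axis i 1)) = f x"
    by simp
  moreover have "x + (\<Sum>i\<in>UNIV. (of_int (k i) * l) *\<^sub>R axis i 1) \<in> cube a l"
  proof -
    have "a $ i \<le> x $ i + of_int (k i) * l \<and> x $ i + of_int (k i) * l \<le> a $ i + l" for i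
    proof -
      define q where "q = (x $ i - a $ i) / l"
      have "x $ i = a $ i + q * l" and k: "k i = - \<lfloor>q\<rfloor>"
        using \<open>l > 0\<close> by (simp_all add: q_def k_def)
      moreover have "of_int \<lfloor>q\<rfloor> * l \<le> q * l" "q * l \<le> (of_int \<lfloor>q\<rfloor> + 1) * l"
        using \<open>l > 0\<close> by (intro mult_right_mono; linarith)+
      ultimately show ?thesis
        by (simp add: distrib_right)
    qed
    moreover have "(x + (\<Sum>j\<in>UNIV. (of_int (k j) * l) *\<^sub>R axis j 1)) $ i = x $ i + of_int (k i) * l" for i
      by (simp add: axis_def if_distrib sum.delta cong: if_cong)
    ultimately show ?thesis
      by (simp add: cube_def mem_box_cart)
  qed
  ultimately show thesis
    using that by blast
qed

lemma periodic_frechet_derivative: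
  fixes f :: "real^'n \<Rightarrow> 'b::real_normed_vector"
  assumes "periodic l f" "\<And>x. f differentiable (at x)"
  shows "periodic l (\<lambda>x. frechet_derivative f (at x) h)"
  unfolding periodic_def
proof (intro allI)
  fix x :: "real^'n" and i :: 'n
  have "((\<lambda>y. f (y + l *\<^sub>R axis i 1)) has_derivative frechet_derivative f (at (x + l *\<^sub>R axis i 1))) (at x)"
    by (rule has_derivative_compose[where f = "\<lambda>y. y + l *\<^sub>R axis i 1" and f' = "\<lambda>h. h"])
      (use assms(2) in \<open>auto simp: frechet_derivative_works intro!: derivative_eq_intros\<close>)
  then have "(f has_derivative frechet_derivative f (at (x + l *\<^sub>R axis i 1))) (at x)"
    by (simp add: periodicD[OF assms(1)])
  then show "frechet_derivative f (at (x + l *\<^sub>R axis i 1)) h = frechet_derivative f (at x) h"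
    by (metis frechet_derivative_at)
qed

text \<open>The box of length l + s in direction \<open>i\<close> contains both the cell and its
  translate. The two leftover pieces, each of length s, are translates of one another by one period
  and so carry equal integrals.\<close>

lemma integral_cube_shift:
  fixes f :: "real^'n \<Rightarrow> 'b::euclidean_space"
  assumes "periodic l f" and cont: "continuous_on UNIV f" and "0 \<le> l" "0 \<le> s"
  shows "integral (cube a l) (\<lambda>x. f (x + s *\<^sub>R axis i 1)) = integral (cube a l) f"
proof -
  define k :: "real^'n" where "k = axis i 1"
  define b where "b = (\<chi> i. a $ i + l)"
  have k: "k \<in> Basis" "\<And>x. x \<bullet> k = x $ i"
    by (auto simp: k_def axis_in_Basis_iff inner_axis)
  have kc: "k $ j = (if j = i then 1 else 0)" for j
    by (simp add: k_def axis_def)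
  have int: "f integrable_on cbox c d" for c d
    using cont by (intro integrable_continuous) (auto intro: continuous_on_subset)
  have b: "b $ j = a $ j + l" for j
    by (simp add: b_def)
  have mem: "x \<in> cbox c d \<longleftrightarrow> (\<forall>j. j \<noteq> i \<longrightarrow> c $ j \<le> x $ j \<and> x $ j \<le> d $ j) \<and> c $ i \<le> x $ i \<and> x $ i \<le> d $ i"
    for x c d :: "real^'n"
    unfolding mem_box_cart by metis
  \<comment> \<open>The long box cut at a_i + s (first two lines) and at a_i + l (last two). The
    upper corner \<open>b + (s - l) *\<^sub>R k\<close> has i-th coordinate a_i + s, so it bounds
    the leftover slab of length s. Both cuts lie in the box for all l, s >= 0, also for s >
    l.\<close>
  have box: "cbox a (b + s *\<^sub>R k) \<inter> {x. x \<bullet> k \<le> a $ i + s} = cbox a (b + (s - l) *\<^sub>R k)"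
       "cbox a (b + s *\<^sub>R k) \<inter> {x. x \<bullet> k \<ge> a $ i + s} = cbox (a + s *\<^sub>R k) (b + s *\<^sub>R k)"
       "cbox a (b + s *\<^sub>R k) \<inter> {x. x \<bullet> k \<le> a $ i + l} = cbox a b"
       "cbox a (b + s *\<^sub>R k) \<inter> {x. x \<bullet> k \<ge> a $ i + l} = cbox (a + l *\<^sub>R k) (b + (s - l) *\<^sub>R k + l *\<^sub>R k)"
    using \<open>0 \<le> l\<close> \<open>0 \<le> s\<close>
    by (auto simp: set_eq_iff mem k(2) kc b)
  have "integral (cbox (a + s *\<^sub>R k) (b + s *\<^sub>R k)) f + integral (cbox a (b + (s - l) *\<^sub>R k)) f
      = integral (cbox a b) f + integral (cbox (a + l *\<^sub>R k) (b + (s - l) *\<^sub>R k + l *\<^sub>R k)) f"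
    using integral_split[OF int k(1), of a "b + s *\<^sub>R k" "a $ i + s"]
      integral_split[OF int k(1), of a "b + s *\<^sub>R k" "a $ i + l"]
    by (simp add: box)
  also have "integral (cbox (a + l *\<^sub>R k) (b + (s - l) *\<^sub>R k + l *\<^sub>R k)) f
      = integral (cbox a (b + (s - l) *\<^sub>R k)) f"
    unfolding integral_shift_cbox_plus[symmetric]
    by (simp add: o_def add.commute[of "l *\<^sub>R axis i 1"] k_def periodicD[OF assms(1)])
  finally have "integral (cbox (a + s *\<^sub>R k) (b + s *\<^sub>R k)) f = integral (cbox a b) f"
    by simp
  then show ?thesis
    unfolding integral_shift_cbox_plus[symmetric]
    by (simp add: o_def add.commute[of "s *\<^sub>R axis i 1"] cube_def k_def b_def)
qed

text \<open>The integral over a period cell does not change under translation; differentiate it with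
  respect to the translation.\<close>

lemma integral_cube_partial_eq_0:
  fixes f :: "real^'n \<Rightarrow> real"
  assumes per: "periodic l f" and f: "C1_on UNIV f" and "0 < l"
  shows "integral (cube a l) (\<lambda>x. frechet_derivative f (at x) (axis i 1)) = 0"
proof -
  define b where "b = (\<chi> i. a $ i + l)"
  define k :: "real^'n" where "k = axis i 1"
  have "((\<lambda>s. integral (cbox a b) (\<lambda>x. f (x + s *\<^sub>R k))) has_vector_derivative
      integral (cbox a b) (\<lambda>x. frechet_derivative f (at (x + 0 *\<^sub>R k)) k)) (at 0 within {0..1})"
  proof (rule leibniz_rule_vector_derivative)
    show "((\<lambda>s. f (x + s *\<^sub>R k)) has_vector_derivative frechet_derivative f (at (x + s *\<^sub>R k)) k)
        (at s within {0..1})" for s x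
    proof -
      have "((\<lambda>s. f (x + s *\<^sub>R k)) has_derivative (\<lambda>h. frechet_derivative f (at (x + s *\<^sub>R k)) (h *\<^sub>R k)))
          (at s within {0..1})"
        by (rule has_derivative_compose[OF _ C1_onD(2)[OF f UNIV_I]]) (auto intro!: derivative_eq_intros)
      then show ?thesis
        by (simp add: has_vector_derivative_def
            linear_cmul[OF linear_frechet_derivative[OF C1_onD(1)[OF f UNIV_I]]])
    qed
    show "(\<lambda>x. f (x + s *\<^sub>R k)) integrable_on cbox a b" for s
      by (intro integrable_continuous continuous_on_compose2[OF C1_onD(4)[OF f]] continuous_intros) auto
    show "continuous_on ({0..1} \<times> cbox a b) (\<lambda>(s, x). frechet_derivative f (at (x + s *\<^sub>R k)) k)"
      unfolding split_beta
      by (intro continuous_on_compose2[OF C1_onD(3)[OF f, of k]] continuous_intros) auto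
  qed auto
  \<comment> \<open>Translation invariance is available for nonnegative shifts, so the derivative at
    0 is one-sided. It is still unique, because 0 is a limit point of [0,1].\<close>
  moreover have "((\<lambda>s. integral (cbox a b) (\<lambda>x. f (x + s *\<^sub>R k))) has_vector_derivative 0) (at 0 within {0..1})"
  proof (rule has_vector_derivative_transform[where f = "\<lambda>_. integral (cbox a b) f"])
    show "integral (cbox a b) (\<lambda>x. f (x + s *\<^sub>R k)) = integral (cbox a b) f" if "s \<in> {0..1}" for s
      using integral_cube_shift[OF per C1_onD(4)[OF f], of s a i] that \<open>0 < l\<close>
      by (simp add: cube_def b_def k_def)
  qed auto
  ultimately have "integral (cbox a b) (\<lambda>x. frechet_derivative f (at x) k) = 0"
    using vector_derivative_unique_within[of 0 "{0..1}"]
    by (simp add: trivial_limit_within islimpt_Icc)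
  then show ?thesis
    by (simp add: cube_def b_def k_def)
qed

lemma divergence_eq_sum: "divergence F x = (\<Sum>i\<in>UNIV. frechet_derivative F (at x) (axis i 1) $ i)"
  by (simp add: divergence_def trace_def jacobian_def matrix_def)

lemma continuous_on_divergence:
  assumes "C1_on S F"
  shows "continuous_on S (divergence F)"
proof -
  have "continuous_on S (\<lambda>x. \<Sum>i\<in>UNIV. frechet_derivative F (at x) (axis i 1) $ i)"
    by (intro continuous_intros C1_onD(3)[OF assms])
  then show ?thesis
    by (simp add: divergence_eq_sum[abs_def])
qed

text \<open>Each diagonal term vanishes by itself, through translation along its own axis.\<close>

theorem integral_cube_divergence_eq_0:
  fixes F :: "real^'n \<Rightarrow> real^'n"
  assumes per: "periodic l F" and F: "C1_on UNIV F" and "0 < l"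
  shows "integral (cube a l) (divergence F) = 0"
proof -
  have comp: "C1_on UNIV (\<lambda>x. F x $ i)" for i
    using F by (rule C1_on_nth)
  have deriv: "frechet_derivative F (at x) h $ i = frechet_derivative (\<lambda>x. F x $ i) (at x) h" for x h i
  proof -
    have "((\<lambda>x. F x $ i) has_derivative (\<lambda>h. frechet_derivative F (at x) h $ i)) (at x)"
      by (rule bounded_linear.has_derivative[OF bounded_linear_vec_nth C1_onD(2)[OF F UNIV_I]])
    from frechet_derivative_at[OF this] show ?thesis
      by (rule fun_cong)
  qed
  have "integral (cube a l) (divergence F)
      = integral (cube a l) (\<lambda>x. \<Sum>i\<in>UNIV. frechet_derivative (\<lambda>x. F x $ i) (at x) (axis i 1))"
    by (simp add: divergence_eq_sum[abs_def] deriv)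
  also have "\<dots> = (\<Sum>i\<in>UNIV. integral (cube a l) (\<lambda>x. frechet_derivative (\<lambda>x. F x $ i) (at x) (axis i 1)))"
    unfolding cube_def
    by (intro integral_sum integrable_continuous continuous_on_subset[OF C1_onD(3)[OF comp]]) auto
  also have "\<dots> = 0"
    using per \<open>0 < l\<close> by (intro sum.neutral ballI integral_cube_partial_eq_0 comp) (auto simp: periodic_def)
  finally show ?thesis .
qed

section \<open>Vector calculus\<close>

lemma grad_eqI:
  assumes "(f has_derivative (\<lambda>h. g \<bullet> h)) (at x)"
  shows "grad f x = g"
proof -
  have "frechet_derivative f (at x) = (\<lambda>h. g \<bullet> h)"
    using frechet_derivative_at[OF assms] by simp
  then show ?thesis
    by (simp add: grad_def vec_eq_iff inner_axis)
qed

lemma has_derivative_grad: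
  assumes "f differentiable (at x)"
  shows "(f has_derivative (\<lambda>h. grad f x \<bullet> h)) (at x)"
proof -
  have "frechet_derivative f (at x) h = grad f x \<bullet> h" for h
    by (subst frechet_derivative_Basis_sum[OF assms], subst euclidean_inner)
      (auto simp: grad_def Basis_vec_def inner_axis inner_axis' intro!: sum.cong)
  then have "frechet_derivative f (at x) = (\<lambda>h. grad f x \<bullet> h)"
    by (rule ext)
  then show ?thesis
    using assms by (metis frechet_derivative_works)
qed

lemma grad_const [simp]: "grad (\<lambda>_. c) x = 0"
  by (rule grad_eqI) simp

lemma grad_add:
  assumes "f differentiable (at x)" "g differentiable (at x)"
  shows "grad (\<lambda>y. f y + g y) x = grad f x + grad g x"
  by (rule grad_eqI) (use assms in \<open>auto intro!: derivative_eq_intros has_derivative_grad simp: inner_add_left\<close>)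

lemma grad_diff:
  assumes "f differentiable (at x)" "g differentiable (at x)"
  shows "grad (\<lambda>y. f y - g y) x = grad f x - grad g x"
  by (rule grad_eqI) (use assms in \<open>auto intro!: derivative_eq_intros has_derivative_grad simp: inner_diff_left\<close>)

lemma grad_mult:
  assumes "f differentiable (at x)" "g differentiable (at x)"
  shows "grad (\<lambda>y. f y * g y) x = f x *\<^sub>R grad g x + g x *\<^sub>R grad f x"
  by (rule grad_eqI)
    (rule derivative_eq_intros has_derivative_grad assms | simp add: inner_add_left mult.commute)+

lemma grad_const_divide:
  assumes "f differentiable (at x)" "f x \<noteq> 0"
  shows "grad (\<lambda>y. c / f y) x = - (c / (f x)\<^sup>2) *\<^sub>R grad f x"
  by (rule grad_eqI)
    (rule derivative_eq_intros has_derivative_grad assms refl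
      | simp add: fun_eq_iff field_simps power2_eq_square)+

lemma has_derivative_jacobian:
  fixes f :: "real^'n \<Rightarrow> real^'m"
  shows "f differentiable (at x) \<Longrightarrow> (f has_derivative (\<lambda>h. jacobian f (at x) *v h)) (at x)"
  by (rule jacobian_works[THEN iffD1])

lemma differentiable_vec_nth: "f differentiable F \<Longrightarrow> (\<lambda>x. f x $ i) differentiable F"
  by (auto simp: differentiable_def intro: bounded_linear.has_derivative[OF bounded_linear_vec_nth])

lemma grad_component:
  assumes "v differentiable (at x)"
  shows "grad (\<lambda>y. v y $ i) x = jacobian v (at x) $ i"
proof (rule grad_eqI)
  show "((\<lambda>y. v y $ i) has_derivative (\<lambda>h. jacobian v (at x) $ i \<bullet> h)) (at x)"
    using bounded_linear.has_derivative[OF bounded_linear_vec_nth has_derivative_jacobian[OF assms], of i]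
    by (simp add: matrix_vector_mul_component)
qed

text \<open>The row product \<open>v*\<close> is the transposed Jacobian acting on a vector. Paired
  with \<open>u\<close>, it becomes the convective expressions of the skew-symmetric form.\<close>

lemma grad_inner:
  fixes v w :: "real^'n \<Rightarrow> real^'n"
  assumes "v differentiable (at x)" "w differentiable (at x)"
  shows "grad (\<lambda>y. v y \<bullet> w y) x = v x v* jacobian w (at x) + w x v* jacobian v (at x)"
proof (rule grad_eqI)
  have "((\<lambda>y. v y \<bullet> w y) has_derivative
      (\<lambda>h. v x \<bullet> (jacobian w (at x) *v h) + (jacobian v (at x) *v h) \<bullet> w x)) (at x)"
    using assms by (intro has_derivative_inner has_derivative_jacobian)
  then show "((\<lambda>y. v y \<bullet> w y) has_derivative
      (\<lambda>h. (v x v* jacobian w (at x) + w x v* jacobian v (at x)) \<bullet> h)) (at x)"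
    by (simp add: inner_add_left dot_lmul_matrix inner_commute[of "w x"])
qed

lemma divergence_eqI:
  "(F has_derivative F') (at x) \<Longrightarrow> divergence F x = (\<Sum>i\<in>UNIV. F' (axis i 1) $ i)"
  by (metis divergence_eq_sum frechet_derivative_at)

lemma divergence_scaleR:
  assumes "f differentiable (at x)" "F differentiable (at x)"
  shows "divergence (\<lambda>y. f y *\<^sub>R F y) x = grad f x \<bullet> F x + f x * divergence F x"
proof -
  have "((\<lambda>y. f y *\<^sub>R F y) has_derivative
      (\<lambda>h. f x *\<^sub>R frechet_derivative F (at x) h + (grad f x \<bullet> h) *\<^sub>R F x)) (at x)"
    using assms by (intro has_derivative_scaleR has_derivative_grad) (auto simp: frechet_derivative_works)
  from divergence_eqI[OF this] show ?thesis
    by (simp add: divergence_eq_sum inner_axis sum.distrib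
        sum_distrib_left inner_vec_def[of "grad f x" "F x"])
qed

lemma divergence_add:
  assumes "F differentiable (at x)" "G differentiable (at x)"
  shows "divergence (\<lambda>y. F y + G y) x = divergence F x + divergence G x"
proof -
  have "((\<lambda>y. F y + G y) has_derivative
      (\<lambda>h. frechet_derivative F (at x) h + frechet_derivative G (at x) h)) (at x)"
    using assms by (intro has_derivative_add) (auto simp: frechet_derivative_works)
  from divergence_eqI[OF this] show ?thesis
    by (simp add: divergence_eq_sum sum.distrib)
qed

lemma divergence_diff:
  assumes "F differentiable (at x)" "G differentiable (at x)"
  shows "divergence (\<lambda>y. F y - G y) x = divergence F x - divergence G x"
proof -
  have "((\<lambda>y. F y - G y) has_derivative
      (\<lambda>h. frechet_derivative F (at x) h - frechet_derivative G (at x) h)) (at x)"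
    using assms by (intro has_derivative_diff) (auto simp: frechet_derivative_works)
  from divergence_eqI[OF this] show ?thesis
    by (simp add: divergence_eq_sum sum_subtractf)
qed

lemma divergence_sum:
  assumes "\<And>i. i \<in> I \<Longrightarrow> F i differentiable (at x)"
  shows "divergence (\<lambda>y. \<Sum>i\<in>I. F i y) x = (\<Sum>i\<in>I. divergence (F i) x)"
proof -
  have "((\<lambda>y. \<Sum>i\<in>I. F i y) has_derivative
      (\<lambda>h. \<Sum>i\<in>I. frechet_derivative (F i) (at x) h)) (at x)"
    using assms by (intro has_derivative_sum) (auto simp: frechet_derivative_works)
  from divergence_eqI[OF this] show ?thesis
    by (simp add: divergence_eq_sum sum.swap[of _ I])
qed

text \<open>\<open>matrix_divergence\<close> acts on rows, so the product rule applies directly to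
  the combination of rows with coefficients \<open>v y $ i\<close>.\<close>

lemma divergence_vector_matrix_mult:
  fixes A :: "real^'n \<Rightarrow> real^'n^'n"
  assumes A: "A differentiable (at x)" and v: "v differentiable (at x)"
  shows "divergence (\<lambda>y. v y v* A y) x = matrix_divergence A x \<bullet> v x + A x \<bullet> jacobian v (at x)"
proof -
  have comp: "(\<lambda>y. A y $ i) differentiable (at x)" "(\<lambda>y. v y $ i) differentiable (at x)" for i
    using A v by (auto intro: differentiable_vec_nth)
  have "v y v* A y = (\<Sum>i\<in>UNIV. v y $ i *\<^sub>R A y $ i)" for y
    by (simp add: vector_matrix_mult_def vec_eq_iff mult.commute)
  then have "divergence (\<lambda>y. v y v* A y) x = (\<Sum>i\<in>UNIV. divergence (\<lambda>y. v y $ i *\<^sub>R A y $ i) x)"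
    by (simp add: divergence_sum differentiable_scaleR comp)
  also have "\<dots> = (\<Sum>i\<in>UNIV. jacobian v (at x) $ i \<bullet> A x $ i + v x $ i * divergence (\<lambda>y. A y $ i) x)"
    by (simp add: divergence_scaleR comp grad_component[OF v])
  also have "\<dots> = matrix_divergence A x \<bullet> v x + A x \<bullet> jacobian v (at x)"
    by (simp add: matrix_divergence_def inner_vec_def[of "A x"] inner_vec_def[of _ "v x"]
        sum.distrib mult.commute inner_commute[of "jacobian v (at x) $ i" for i])
  finally show ?thesis .
qed

text \<open>Symmetry turns the column product into the row product. This is why every stress to
  which the rule is applied must be shown symmetric.\<close>

lemma divergence_matrix_vector_mult:
  fixes A :: "real^'n \<Rightarrow> real^'n^'n"
  assumes "A differentiable (at x)" "v differentiable (at x)" and sym: "\<And>y. transpose (A y) = A y"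
  shows "divergence (\<lambda>y. A y *v v y) x = matrix_divergence A x \<bullet> v x + A x \<bullet> jacobian v (at x)"
  using divergence_vector_matrix_mult[OF assms(1,2)]
  by (simp add: sym flip: transpose_matrix_vector)

definition outer :: "real^'n \<Rightarrow> real^'n^'n" where
  "outer g = (\<chi> i j. g $ i * g $ j)"

lemma outer_nth: "outer g $ i = g $ i *\<^sub>R g"
  by (simp add: outer_def vec_eq_iff)

lemma outer_mult_vector: "outer g *v h = (g \<bullet> h) *\<^sub>R g"
  by (simp add: vec_eq_iff matrix_vector_mul_component outer_nth)

text \<open>Row i is the scalar c g_i times the vector g. The intended instance is the Korteweg
  stress, with c = \<gamma>/\<theta> and g = \<nabla>\<phi>.\<close>

lemma matrix_divergence_scaleR_outer:
  assumes c: "c differentiable (at x)" and g: "g differentiable (at x)"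
  shows "matrix_divergence (\<lambda>y. c y *\<^sub>R outer (g y)) x
    = c x *\<^sub>R (jacobian g (at x) *v g x) + (grad c x \<bullet> g x + c x * divergence g x) *\<^sub>R g x"
proof -
  have gi: "(\<lambda>y. g y $ i) differentiable (at x)" for i
    using g by (rule differentiable_vec_nth)
  have "divergence (\<lambda>y. (c y * g y $ i) *\<^sub>R g y) x
      = c x * (jacobian g (at x) $ i \<bullet> g x) + (grad c x \<bullet> g x + c x * divergence g x) * g x $ i" for i
    using c g gi
    by (simp add: divergence_scaleR grad_mult grad_component differentiable_mult inner_add_left algebra_simps)
  then show ?thesis
    by (simp add: matrix_divergence_def vec_eq_iff outer_nth matrix_vector_mul_component)
qed

section \<open>Second order regularity, the Hessian and periodicity of derivatives\<close>

lemma Ck_on_mono: "Ck_on k f S \<Longrightarrow> j \<le> k \<Longrightarrow> Ck_on j f S"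
  by (auto simp: Ck_on_def)

text \<open>\<open>iter_deriv\<close> differentiates along the head of the list first, so the
  conditions for the derivative along \<open>b\<close> are those for \<open>f\<close> with the lists
  \<open>b # bs\<close>.\<close>

lemma Ck_on_2D:
  assumes "Ck_on 2 f S"
  shows "C1_on S f" and "b \<in> Basis \<Longrightarrow> C1_on S (\<lambda>x. frechet_derivative f (at x) b)"
proof -
  show "C1_on S f"
    using Ck_on_mono[OF assms, of 1] by (simp only: Ck_on_1_iff)
  show "C1_on S (\<lambda>x. frechet_derivative f (at x) b)" if "b \<in> Basis"
    unfolding Ck_on_1_iff[symmetric] Ck_on_def
  proof (intro conjI allI impI)
    fix bs :: "'a list"
    show "\<forall>x\<in>S. iter_deriv bs (\<lambda>x. frechet_derivative f (at x) b) differentiable (at x)"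
      if "set bs \<subseteq> Basis \<and> length bs < 1"
      using assms that \<open>b \<in> Basis\<close> unfolding Ck_on_def
      by (drule_tac conjunct1) (drule spec[of _ "b # bs"], simp)
    show "continuous_on S (iter_deriv bs (\<lambda>x. frechet_derivative f (at x) b))"
      if "set bs \<subseteq> Basis \<and> length bs \<le> 1"
      using assms that \<open>b \<in> Basis\<close> unfolding Ck_on_def
      by (drule_tac conjunct2) (drule spec[of _ "b # bs"], simp)
  qed
qed

lemma axis_in_Basis: "axis i (1::real) \<in> Basis"
  by (simp add: axis_in_Basis_iff)

lemma C1_on_grad: "Ck_on 2 f S \<Longrightarrow> C1_on S (grad f)"
  unfolding grad_def[abs_def] by (intro C1_on_vec Ck_on_2D(2) axis_in_Basis)

lemma C1_on_sym_grad: "Ck_on 2 u S \<Longrightarrow> C1_on S (sym_grad u)"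
  unfolding sym_grad_def[abs_def] jacobian_def matrix_def transpose_def vec_lambda_beta
  by (intro C1_on_scaleR C1_on_const C1_on_add C1_on_vec C1_on_nth Ck_on_2D(2) axis_in_Basis)

text \<open>The gradient of |\<nabla>\<phi>|^2/2 is the transposed Hessian applied to
  \<nabla>\<phi>, while div \<sigma> contains the Hessian itself. Symmetry identifies the
  two.\<close>

lemma transpose_hessian:
  assumes "Ck_on 2 f UNIV"
  shows "transpose (jacobian (grad f) (at x)) = jacobian (grad f) (at x)"
proof -
  have "jacobian (grad f) (at x) $ i $ j = jacobian (grad f) (at x) $ j $ i" for i j
  proof -
    have diff: "grad f differentiable (at x)"
      using C1_onD(1)[OF C1_on_grad[OF assms]] by simp
    have "jacobian (grad f) (at x) $ i $ j
        = frechet_derivative (\<lambda>y. frechet_derivative f (at y) (axis i 1)) (at x) (axis j 1)" for i j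
    proof -
      have "jacobian (grad f) (at x) $ i = grad (\<lambda>y. grad f y $ i) x"
        by (rule grad_component[OF diff, symmetric])
      then show ?thesis
        by (simp add: grad_def)
    qed
    then show ?thesis
      using frechet_derivative_commute[of f "axis i 1" "axis j 1" x] Ck_on_2D[OF assms] C1_onD(1)[OF Ck_on_2D(1)[OF assms]]
      by (simp add: axis_in_Basis)
  qed
  then show ?thesis
    by (simp add: transpose_def vec_eq_iff)
qed

lemma periodic_grad: "periodic l f \<Longrightarrow> C1_on UNIV f \<Longrightarrow> periodic l (grad f)"
  using periodic_frechet_derivative[of l f] C1_onD(1)[of UNIV f] by (simp add: periodic_def grad_def)

lemma periodic_jacobian: "periodic l u \<Longrightarrow> C1_on UNIV u \<Longrightarrow> periodic l (\<lambda>x. jacobian u (at x))"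
  using periodic_frechet_derivative[of l u] C1_onD(1)[of UNIV u]
  by (simp add: periodic_def jacobian_def matrix_def)

lemma inner_transpose: "transpose A \<bullet> transpose B = A \<bullet> (B :: real^'n^'m)"
  by (simp add: inner_vec_def transpose_def) (rule sum.swap)

lemma transpose_sym_grad: "transpose (sym_grad u x) = sym_grad u x"
  by (simp add: sym_grad_def transpose_def vec_eq_iff add.commute)

text \<open>A symmetric matrix is Frobenius-orthogonal to the antisymmetric part of the Jacobian.
  This exchanges Dv and \<nabla>v in the viscous terms.\<close>

lemma inner_sym_grad:
  assumes "transpose A = A"
  shows "A \<bullet> sym_grad v x = A \<bullet> jacobian v (at x)"
proof -
  have "A \<bullet> transpose (jacobian v (at x)) = A \<bullet> jacobian v (at x)"
    using inner_transpose[of A "jacobian v (at x)"] assms by simp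
  then show ?thesis
    by (simp add: sym_grad_def inner_add_right)
qed

section \<open>Weak equations\<close>

lemma continuous_on_grad: "C1_on S f \<Longrightarrow> continuous_on S (grad f)"
  unfolding grad_def[abs_def] by (intro continuous_on_vec_lambda C1_onD(3))

lemma continuous_on_jacobian:
  fixes u :: "real^'n \<Rightarrow> real^'m"
  shows "C1_on S u \<Longrightarrow> continuous_on S (\<lambda>x. jacobian u (at x))"
  unfolding jacobian_def matrix_def by (intro continuous_on_vec_lambda continuous_on_component C1_onD(3))

lemma continuous_on_sym_grad: "C1_on S u \<Longrightarrow> continuous_on S (sym_grad u)"
  unfolding sym_grad_def[abs_def] transpose_def
  by (intro continuous_intros continuous_on_vec_lambda continuous_on_component continuous_on_jacobian)

lemma continuous_on_matrix_divergence: "C1_on S A \<Longrightarrow> continuous_on S (matrix_divergence A)"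
  unfolding matrix_divergence_def[abs_def]
  by (intro continuous_on_vec_lambda continuous_on_divergence C1_on_nth)

lemma continuous_on_matrix_vector_mult:
  fixes A :: "'a::topological_space \<Rightarrow> real^'n^'m"
  shows "continuous_on S A \<Longrightarrow> continuous_on S v \<Longrightarrow> continuous_on S (\<lambda>x. A x *v v x)"
  unfolding matrix_vector_mult_def
  by (intro continuous_on_vec_lambda continuous_on_sum continuous_on_mult continuous_on_component)

text \<open>In \<open>has_integral\<close> form a whole weak equation can be assembled into one
  integrand by introduction rules, with continuity as the only side condition.\<close>

lemma has_integral_L2_inner:
  fixes f g :: "real^'n \<Rightarrow> 'b::real_inner"
  assumes "continuous_on (cube a l) f" "continuous_on (cube a l) g"
  shows "((\<lambda>x. f x \<bullet> g x) has_integral \<langle>f, g\<rangle>\<^bsub>cube a l\<^esub>) (cube a l)"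
  unfolding L2_inner_def
  by (intro integrable_integral, unfold cube_def)
    (use assms in \<open>auto simp: cube_def intro!: integrable_continuous continuous_on_inner\<close>)

text \<open>The common last step of the four weak equations. The integrand has to agree with the
  divergence on the cube only, where the strong equation holds, while the flux is periodic and C1 on
  the whole space.\<close>

lemma has_integral_divergence_imp_0:
  fixes F :: "real^'n \<Rightarrow> real^'n"
  assumes g: "(g has_integral I) (cube a l)"
    and eq: "\<And>x. x \<in> cube a l \<Longrightarrow> g x = divergence F x"
    and F: "Ck_per l 1 F" "l > 0"
  shows "0 = I"
proof -
  have "(divergence F has_integral I) (cube a l)"
    using has_integral_eq[OF eq g] .
  then have "integral (cube a l) (divergence F) = I"
    by (rule integral_unique)
  then show ?thesis
    using integral_cube_divergence_eq_0[of l F a] F by (simp only: Ck_per_def Ck_on_1_iff)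
qed

lemma Ck_per_1_iff: "Ck_per l 1 f \<longleftrightarrow> periodic l f \<and> C1_on UNIV f"
  by (simp only: Ck_per_def Ck_on_1_iff)

lemma C1_onD_UNIV:
  assumes "C1_on UNIV f"
  shows "f differentiable (at x)" "continuous_on S f"
  using C1_onD(1)[OF assms, of x] continuous_on_subset[OF C1_onD(4)[OF assms]] by auto

text \<open>Because div u = 0, the transport term satisfies \<psi> u . \<nabla>f + f u .
  \<nabla>\<psi> = div(f \<psi> u), and the diffusive part completes to div(\<psi> G). The function
  \<open>ft\<close> stands for the time derivative.\<close>

lemma weak_transport_diffusion:
  fixes u G :: "real^'n \<Rightarrow> real^'n"
  assumes l: "l > 0" and reg: "Ck_per l 1 f" "Ck_per l 1 \<psi>" "Ck_per l 1 u" "Ck_per l 1 G"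
    and divu: "\<And>x. x \<in> cube a l \<Longrightarrow> divergence u x = 0"
    and eq: "\<And>x. x \<in> cube a l \<Longrightarrow> ft x + u x \<bullet> grad f x - divergence G x = 0"
  shows "0 = \<langle>ft, \<psi>\<rangle>\<^bsub>cube a l\<^esub> - \<langle>\<lambda>x. f x *\<^sub>R u x, grad \<psi>\<rangle>\<^bsub>cube a l\<^esub> + \<langle>G, grad \<psi>\<rangle>\<^bsub>cube a l\<^esub>"
proof -
  have C1: "C1_on UNIV f" "C1_on UNIV \<psi>" "C1_on UNIV u" "C1_on UNIV G"
    and per: "periodic l f" "periodic l \<psi>" "periodic l u" "periodic l G"
    using reg unfolding Ck_per_1_iff by auto
  note diff = C1[THEN C1_onD_UNIV(1)]
  note cont = C1[THEN C1_onD_UNIV(2), of "cube a l"] C1(1,2)[THEN C1_on_subset, THEN continuous_on_grad, of "cube a l"]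
    C1(4)[THEN C1_on_subset, THEN continuous_on_divergence, of "cube a l"]
  have ft: "ft x = divergence G x - u x \<bullet> grad f x" if "x \<in> cube a l" for x
    using eq[OF that] by simp
  have cont_ft: "continuous_on (cube a l) ft"
    by (subst continuous_on_cong[OF refl ft]) (auto intro!: continuous_intros cont)
  show ?thesis
  proof (rule has_integral_divergence_imp_0[OF _ _ _ l])
    show "((\<lambda>x. ft x \<bullet> \<psi> x - (f x *\<^sub>R u x) \<bullet> grad \<psi> x + G x \<bullet> grad \<psi> x) has_integral
        (\<langle>ft, \<psi>\<rangle>\<^bsub>cube a l\<^esub> - \<langle>\<lambda>x. f x *\<^sub>R u x, grad \<psi>\<rangle>\<^bsub>cube a l\<^esub> + \<langle>G, grad \<psi>\<rangle>\<^bsub>cube a l\<^esub>)) (cube a l)"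
      by (intro has_integral_add has_integral_diff has_integral_L2_inner)
        (auto intro!: continuous_intros cont cont_ft)
    show "Ck_per l 1 (\<lambda>x. \<psi> x *\<^sub>R G x - (f x * \<psi> x) *\<^sub>R u x)"
      unfolding Ck_per_1_iff using per
      by (intro conjI C1_on_diff C1_on_scaleR C1_on_mult C1) (simp add: periodic_def)
    show "ft x \<bullet> \<psi> x - (f x *\<^sub>R u x) \<bullet> grad \<psi> x + G x \<bullet> grad \<psi> x
        = divergence (\<lambda>x. \<psi> x *\<^sub>R G x - (f x * \<psi> x) *\<^sub>R u x) x" if "x \<in> cube a l" for x
      by (simp add: divergence_diff divergence_scaleR grad_mult differentiable_scaleR differentiable_mult diff
          ft[OF that] divu[OF that] inner_add_left inner_commute algebra_simps)
  qed
qed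

text \<open>Used with \<open>G\<close> the gradient of the phase field and \<open>f\<close> the
  derivative of \<Psi> in \<phi>. The equation is solved for \<open>f\<close>, which yields its
  continuity from that of \<open>m\<close> and of div G.\<close>

lemma weak_poisson:
  fixes G :: "real^'n \<Rightarrow> real^'n"
  assumes l: "l > 0" and reg: "Ck_per l 1 \<xi>" "Ck_per l 1 G" and m: "continuous_on (cube a l) m"
    and eq: "\<And>x. x \<in> cube a l \<Longrightarrow> m x = - c * divergence G x + f x"
  shows "0 = \<langle>m, \<xi>\<rangle>\<^bsub>cube a l\<^esub> - c * \<langle>G, grad \<xi>\<rangle>\<^bsub>cube a l\<^esub> - \<langle>f, \<xi>\<rangle>\<^bsub>cube a l\<^esub>"
proof -
  have C1: "C1_on UNIV \<xi>" "C1_on UNIV G" and per: "periodic l \<xi>" "periodic l G"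
    using reg unfolding Ck_per_1_iff by auto
  note diff = C1[THEN C1_onD_UNIV(1)]
  note cont = C1[THEN C1_onD_UNIV(2), of "cube a l"] C1(1)[THEN C1_on_subset, THEN continuous_on_grad, of "cube a l"]
    C1(2)[THEN C1_on_subset, THEN continuous_on_divergence, of "cube a l"]
  have f: "f x = m x + c * divergence G x" if "x \<in> cube a l" for x
    using eq[OF that] by simp
  have cont_f: "continuous_on (cube a l) f"
    by (subst continuous_on_cong[OF refl f]) (auto intro!: continuous_intros cont m)
  show ?thesis
  proof (rule has_integral_divergence_imp_0[OF _ _ _ l])
    show "((\<lambda>x. m x \<bullet> \<xi> x - c * (G x \<bullet> grad \<xi> x) - f x \<bullet> \<xi> x) has_integral
        (\<langle>m, \<xi>\<rangle>\<^bsub>cube a l\<^esub> - c * \<langle>G, grad \<xi>\<rangle>\<^bsub>cube a l\<^esub> - \<langle>f, \<xi>\<rangle>\<^bsub>cube a l\<^esub>)) (cube a l)"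
      by (intro has_integral_diff has_integral_mult_right has_integral_L2_inner)
        (auto intro!: cont cont_f m)
    show "Ck_per l 1 (\<lambda>x. (- c * \<xi> x) *\<^sub>R G x)"
      unfolding Ck_per_1_iff using per
      by (intro conjI C1_on_scaleR C1_on_mult C1_on_const C1) (simp add: periodic_def)
    show "m x \<bullet> \<xi> x - c * (G x \<bullet> grad \<xi> x) - f x \<bullet> \<xi> x
        = divergence (\<lambda>x. (- c * \<xi> x) *\<^sub>R G x) x" if "x \<in> cube a l" for x
      by (simp only: divergence_scaleR grad_mult differentiable_mult differentiable_const diff
          f[OF that] grad_const) (simp add: inner_commute algebra_simps)
  qed
qed

text \<open>Here \<open>r\<close> stands for s + \<phi>\<mu>, \<open>A\<close> for
  (\<phi>/\<theta>)\<nabla>\<mu>, \<open>B\<close> for \<sigma>\<nabla>\<theta>/\<theta>, and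
  \<open>K\<close> is the pointwise identity. It replaces w u . (\<nabla>e + A - B) by w u . div
  \<sigma> + (w/\<theta>) u . \<nabla>r. The first part combines with w \<sigma>:\<nabla>u and
  \<sigma>u . \<nabla>w to div(w \<sigma>u), the second with r u . \<nabla>(w/\<theta>) to a
  divergence, by div u = 0.\<close>

lemma weak_energy:
  fixes u G :: "real^'n \<Rightarrow> real^'n"
  assumes l: "l > 0"
    and reg: "Ck_per l 1 e" "Ck_per l 1 \<theta>" "Ck_per l 1 r" "Ck_per l 1 w" "Ck_per l 1 u" "Ck_per l 1 G" "Ck_per l 1 \<sigma>"
    and cont_coeffs: "continuous_on (cube a l) \<nu>" "continuous_on (cube a l) A" "continuous_on (cube a l) B"
    and \<theta>: "\<And>x. \<theta> x \<noteq> 0"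
    and \<sigma>: "\<And>x. transpose (\<sigma> x) = \<sigma> x"
    and divu: "\<And>x. x \<in> cube a l \<Longrightarrow> divergence u x = 0"
    and K: "\<And>x. x \<in> cube a l \<Longrightarrow> grad e x + A x - B x - (1 / \<theta> x) *\<^sub>R grad r x = matrix_divergence \<sigma> x"
    and eq: "\<And>x. x \<in> cube a l \<Longrightarrow> et x + u x \<bullet> grad e x - divergence G x
        - (\<nu> x *\<^sub>R sym_grad u x - \<sigma> x) \<bullet> jacobian u (at x) = 0"
  shows "0 = \<langle>et, w\<rangle>\<^bsub>cube a l\<^esub> + \<langle>G, grad w\<rangle>\<^bsub>cube a l\<^esub>
      - \<langle>\<lambda>x. \<nu> x * (norm (sym_grad u x))\<^sup>2, w\<rangle>\<^bsub>cube a l\<^esub>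
      - \<langle>\<lambda>x. \<sigma> x *v u x, grad w\<rangle>\<^bsub>cube a l\<^esub>
      - \<langle>\<lambda>x. A x - B x, \<lambda>x. w x *\<^sub>R u x\<rangle>\<^bsub>cube a l\<^esub>
      - \<langle>r, \<lambda>x. u x \<bullet> grad (\<lambda>y. w y / \<theta> y) x\<rangle>\<^bsub>cube a l\<^esub>"
proof -
  have C1: "C1_on UNIV e" "C1_on UNIV r" "C1_on UNIV w" "C1_on UNIV (\<lambda>y. w y / \<theta> y)"
      "C1_on UNIV u" "C1_on UNIV G" "C1_on UNIV \<sigma>"
    and per: "periodic l \<theta>" "periodic l r" "periodic l w" "periodic l u" "periodic l G" "periodic l \<sigma>"
    using reg \<theta> unfolding Ck_per_1_iff by (auto intro: C1_on_divide)
  note diff = C1[THEN C1_onD_UNIV(1)]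
  note C1_cube = C1[THEN C1_on_subset[OF _ subset_UNIV], of "cube a l"]
  note cont = cont_coeffs C1_cube[THEN C1_onD(4)] C1_cube(1-4)[THEN continuous_on_grad]
    C1_cube(5-6)[THEN continuous_on_divergence] continuous_on_jacobian[OF C1_cube(5)]
    continuous_on_sym_grad[OF C1_cube(5)]
  have et: "et x = divergence G x - u x \<bullet> grad e x
      + (\<nu> x *\<^sub>R sym_grad u x - \<sigma> x) \<bullet> jacobian u (at x)" if "x \<in> cube a l" for x
    using eq[OF that] by simp
  have cont_et: "continuous_on (cube a l) et"
    by (subst continuous_on_cong[OF refl et]) (auto intro!: continuous_intros cont)
  \<comment> \<open>The strong equation has Du:\<nabla>u where the weak one has |Du|^2.\<close>
  have dissipation: "(norm (sym_grad u x))\<^sup>2 = sym_grad u x \<bullet> jacobian u (at x)" for x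
    by (simp add: power2_norm_eq_inner inner_sym_grad transpose_sym_grad)
  show ?thesis
  proof (rule has_integral_divergence_imp_0[OF _ _ _ l])
    show "((\<lambda>x. et x \<bullet> w x + G x \<bullet> grad w x - (\<nu> x * (norm (sym_grad u x))\<^sup>2) \<bullet> w x
        - (\<sigma> x *v u x) \<bullet> grad w x - (A x - B x) \<bullet> (w x *\<^sub>R u x)
        - r x \<bullet> (u x \<bullet> grad (\<lambda>y. w y / \<theta> y) x)) has_integral
      (\<langle>et, w\<rangle>\<^bsub>cube a l\<^esub> + \<langle>G, grad w\<rangle>\<^bsub>cube a l\<^esub>
      - \<langle>\<lambda>x. \<nu> x * (norm (sym_grad u x))\<^sup>2, w\<rangle>\<^bsub>cube a l\<^esub>
      - \<langle>\<lambda>x. \<sigma> x *v u x, grad w\<rangle>\<^bsub>cube a l\<^esub>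
      - \<langle>\<lambda>x. A x - B x, \<lambda>x. w x *\<^sub>R u x\<rangle>\<^bsub>cube a l\<^esub>
      - \<langle>r, \<lambda>x. u x \<bullet> grad (\<lambda>y. w y / \<theta> y) x\<rangle>\<^bsub>cube a l\<^esub>)) (cube a l)"
      by (intro has_integral_add has_integral_diff has_integral_L2_inner)
        (auto intro!: continuous_intros continuous_on_matrix_vector_mult cont cont_et)
    show "Ck_per l 1 (\<lambda>x. w x *\<^sub>R G x - (r x * (w x / \<theta> x)) *\<^sub>R u x - w x *\<^sub>R (\<sigma> x *v u x))"
      unfolding Ck_per_1_iff using per
      by (intro conjI C1_on_diff C1_on_scaleR C1_on_mult C1_on_matrix_vector_mult C1)
        (simp add: periodic_def)
    show "et x \<bullet> w x + G x \<bullet> grad w x - (\<nu> x * (norm (sym_grad u x))\<^sup>2) \<bullet> w x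
        - (\<sigma> x *v u x) \<bullet> grad w x - (A x - B x) \<bullet> (w x *\<^sub>R u x)
        - r x \<bullet> (u x \<bullet> grad (\<lambda>y. w y / \<theta> y) x)
      = divergence (\<lambda>x. w x *\<^sub>R G x - (r x * (w x / \<theta> x)) *\<^sub>R u x - w x *\<^sub>R (\<sigma> x *v u x)) x"
      if x: "x \<in> cube a l" for x
    proof -
      have \<sigma>u: "(\<lambda>x. \<sigma> x *v u x) differentiable (at x)"
        using C1_onD_UNIV(1)[OF C1_on_matrix_vector_mult[OF C1(7,5)]] .
      have "divergence (\<lambda>x. w x *\<^sub>R G x - (r x * (w x / \<theta> x)) *\<^sub>R u x - w x *\<^sub>R (\<sigma> x *v u x)) x
        = grad w x \<bullet> G x + w x * divergence G x
          - (r x * (grad (\<lambda>y. w y / \<theta> y) x \<bullet> u x) + (w x / \<theta> x) * (grad r x \<bullet> u x))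
          - (grad w x \<bullet> (\<sigma> x *v u x) + w x * (matrix_divergence \<sigma> x \<bullet> u x + \<sigma> x \<bullet> jacobian u (at x)))"
        by (subst divergence_diff divergence_scaleR grad_mult divergence_matrix_vector_mult[OF _ _ \<sigma>]
            | intro differentiable_diff differentiable_scaleR differentiable_mult diff \<sigma>u)+
          (simp add: divu[OF x] inner_add_left)
      then show ?thesis
        by (simp add: et[OF x] dissipation K[OF x, symmetric] inner_add_left inner_diff_left inner_commute
            inner_diff_right inner_add_right algebra_simps)
    qed
  qed
qed

lemma inner_mat_1: "mat 1 \<bullet> A = trace (A :: real^'n^'n)"
  by (simp add: inner_vec_def mat_def trace_def if_distrib[of "\<lambda>c. c * _"] cong: if_cong)

text \<open>The letters have the same meaning as in the energy equation. By \<open>K\<close>, the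
  force \<open>A - B\<close> plus r\<nabla>(1/\<theta>) equals div \<sigma> - \<nabla>(e -
  r/\<theta>); the gradient, tested with \<open>v\<close>, completes (e - r/\<theta>) div v to a
  divergence. Half of the convective term is moved onto \<open>v\<close>, at the cost of div((u .
  v)u)/2.\<close>

lemma weak_momentum:
  fixes u v :: "real^'n \<Rightarrow> real^'n"
  assumes l: "l > 0"
    and reg: "Ck_per l 1 e" "Ck_per l 1 \<theta>" "Ck_per l 1 r" "Ck_per l 1 p" "Ck_per l 1 u" "Ck_per l 1 v"
      "Ck_per l 1 \<sigma>" "Ck_per l 1 \<nu>" "Ck_per l 1 (sym_grad u)"
    and cont_coeffs: "continuous_on (cube a l) A" "continuous_on (cube a l) B"
    and \<theta>: "\<And>x. \<theta> x \<noteq> 0"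
    and \<sigma>: "\<And>x. transpose (\<sigma> x) = \<sigma> x"
    and divu: "\<And>x. x \<in> cube a l \<Longrightarrow> divergence u x = 0"
    and K: "\<And>x. x \<in> cube a l \<Longrightarrow> grad e x + A x - B x - (1 / \<theta> x) *\<^sub>R grad r x = matrix_divergence \<sigma> x"
    and eq: "\<And>x. x \<in> cube a l \<Longrightarrow> ut x + jacobian u (at x) *v u x
        - matrix_divergence (\<lambda>y. \<nu> y *\<^sub>R sym_grad u y - p y *\<^sub>R mat 1 - \<sigma> y) x = 0"
  shows "0 = \<langle>ut, v\<rangle>\<^bsub>cube a l\<^esub> + conv_skw (cube a l) u u v
      + \<langle>\<lambda>x. \<nu> x *\<^sub>R sym_grad u x, sym_grad v\<rangle>\<^bsub>cube a l\<^esub>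
      - \<langle>\<lambda>x. p x + e x - r x / \<theta> x, divergence v\<rangle>\<^bsub>cube a l\<^esub>
      + \<langle>\<lambda>x. A x + r x *\<^sub>R grad (\<lambda>y. 1 / \<theta> y) x - B x, v\<rangle>\<^bsub>cube a l\<^esub>"
proof -
  define S where "S = (\<lambda>y. \<nu> y *\<^sub>R sym_grad u y - p y *\<^sub>R mat 1 - \<sigma> y)"
  have C1: "C1_on UNIV e" "C1_on UNIV r" "C1_on UNIV (\<lambda>y. 1 / \<theta> y)" "C1_on UNIV p"
      "C1_on UNIV u" "C1_on UNIV v" "C1_on UNIV \<nu>" "C1_on UNIV (sym_grad u)" "C1_on UNIV \<sigma>"
    and per: "periodic l e" "periodic l \<theta>" "periodic l r" "periodic l p" "periodic l u" "periodic l v"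
      "periodic l \<sigma>" "periodic l \<nu>" "periodic l (sym_grad u)"
    using reg \<theta> unfolding Ck_per_1_iff by (auto intro: C1_on_divide C1_on_const)
  have C1_S: "C1_on UNIV S"
    unfolding S_def by (intro C1_on_diff C1_on_scaleR C1_on_const C1)
  note diff = C1[THEN C1_onD_UNIV(1)] C1_onD_UNIV(1)[OF C1_S]
  note C1_cube = C1[THEN C1_on_subset[OF _ subset_UNIV], of "cube a l"]
  note cont = cont_coeffs C1_cube[THEN C1_onD(4)] C1_cube(1-4)[THEN continuous_on_grad]
    C1_cube(5-6)[THEN continuous_on_divergence] C1_cube(5-6)[THEN continuous_on_jacobian]
    C1_cube(5-6)[THEN continuous_on_sym_grad]
    continuous_on_matrix_divergence[OF C1_on_subset[OF C1_S subset_UNIV], of "cube a l"]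
  have cont_r\<theta>: "continuous_on (cube a l) (\<lambda>x. r x / \<theta> x)"
    using continuous_on_mult[OF cont(4,5)] by simp
  have ut: "ut x = matrix_divergence S x - jacobian u (at x) *v u x" if "x \<in> cube a l" for x
    using eq[OF that] by (simp add: S_def eq_diff_eq)
  have cont_ut: "continuous_on (cube a l) ut"
    by (subst continuous_on_cong[OF refl ut])
      (auto intro!: continuous_intros continuous_on_matrix_vector_mult cont)
  \<comment> \<open>Required by the product rule for the divergence of S v.\<close>
  have S: "transpose (S x) = S x" for x
  proof -
    have "transpose (M - N) = transpose M - transpose N" "transpose (c *\<^sub>R M) = c *\<^sub>R transpose M"
      for M N :: "real^'n^'n" and c :: real
      by (simp_all add: transpose_def vec_eq_iff)
    then show ?thesis
      by (simp add: S_def transpose_sym_grad \<sigma> transpose_mat)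
  qed
  \<comment> \<open>The total stress S contains -\<sigma>, whose pairing with \<nabla>v has no
    counterpart in the weak form. Adding \<sigma>v cancels it and leaves div \<sigma> . v, which
    \<open>K\<close> supplies. The pressure is already inside S.\<close>
  let ?F = "\<lambda>x. S x *v v x + \<sigma> x *v v x - (1/2 * (u x \<bullet> v x)) *\<^sub>R u x - (e x - r x * (1 / \<theta> x)) *\<^sub>R v x"
  show ?thesis
  proof (rule has_integral_divergence_imp_0[OF _ _ _ l])
    show "((\<lambda>x. ut x \<bullet> v x
        + (1/2 * ((jacobian u (at x) *v u x) \<bullet> v x) - 1/2 * ((jacobian v (at x) *v u x) \<bullet> u x))
        + (\<nu> x *\<^sub>R sym_grad u x) \<bullet> sym_grad v x - (p x + e x - r x / \<theta> x) \<bullet> divergence v x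
        + (A x + r x *\<^sub>R grad (\<lambda>y. 1 / \<theta> y) x - B x) \<bullet> v x) has_integral
      (\<langle>ut, v\<rangle>\<^bsub>cube a l\<^esub> + conv_skw (cube a l) u u v
      + \<langle>\<lambda>x. \<nu> x *\<^sub>R sym_grad u x, sym_grad v\<rangle>\<^bsub>cube a l\<^esub>
      - \<langle>\<lambda>x. p x + e x - r x / \<theta> x, divergence v\<rangle>\<^bsub>cube a l\<^esub>
      + \<langle>\<lambda>x. A x + r x *\<^sub>R grad (\<lambda>y. 1 / \<theta> y) x - B x, v\<rangle>\<^bsub>cube a l\<^esub>)) (cube a l)"
      unfolding conv_skw_def conv_def
      by (intro has_integral_add has_integral_diff has_integral_mult_right has_integral_L2_inner
          continuous_on_add continuous_on_diff continuous_on_scaleR continuous_on_matrix_vector_mult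
          cont cont_ut cont_r\<theta>)
    show "Ck_per l 1 ?F"
      unfolding Ck_per_1_iff using per
      by (intro conjI C1_on_diff C1_on_add C1_on_scaleR C1_on_mult C1_on_const C1_on_inner
          C1_on_matrix_vector_mult C1 C1_S)
        (simp add: periodic_def S_def)
    show "ut x \<bullet> v x
        + (1/2 * ((jacobian u (at x) *v u x) \<bullet> v x) - 1/2 * ((jacobian v (at x) *v u x) \<bullet> u x))
        + (\<nu> x *\<^sub>R sym_grad u x) \<bullet> sym_grad v x - (p x + e x - r x / \<theta> x) \<bullet> divergence v x
        + (A x + r x *\<^sub>R grad (\<lambda>y. 1 / \<theta> y) x - B x) \<bullet> v x = divergence ?F x"
      if x: "x \<in> cube a l" for x
    proof -
      have Mv: "(\<lambda>x. S x *v v x) differentiable (at x)" "(\<lambda>x. \<sigma> x *v v x) differentiable (at x)"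
        using C1_onD_UNIV(1)[OF C1_on_matrix_vector_mult] C1 C1_S by blast+
      \<comment> \<open>The viscous part, being symmetric, pairs with Dv, and the identity matrix
        produces div v. The term \<sigma>:\<nabla>v is kept as it is, for the cancellation.\<close>
      have stress: "S x \<bullet> jacobian v (at x)
          = \<nu> x * (sym_grad u x \<bullet> sym_grad v x) - p x * divergence v x - \<sigma> x \<bullet> jacobian v (at x)"
        by (simp add: S_def inner_diff_left inner_mat_1 divergence_def inner_sym_grad transpose_sym_grad)
      have "divergence ?F x = matrix_divergence S x \<bullet> v x + S x \<bullet> jacobian v (at x)
          + (matrix_divergence \<sigma> x \<bullet> v x + \<sigma> x \<bullet> jacobian v (at x))
          - 1/2 * (u x \<bullet> (jacobian v (at x) *v u x) + v x \<bullet> (jacobian u (at x) *v u x))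
          - ((grad e x - (r x *\<^sub>R grad (\<lambda>y. 1 / \<theta> y) x + (1 / \<theta> x) *\<^sub>R grad r x)) \<bullet> v x
             + (e x - r x * (1 / \<theta> x)) * divergence v x)"
        by (subst divergence_diff divergence_add divergence_scaleR grad_diff grad_mult grad_inner grad_const
            divergence_matrix_vector_mult[OF _ _ \<sigma>] divergence_matrix_vector_mult[OF _ _ S]
            | intro differentiable_diff differentiable_add differentiable_scaleR differentiable_mult
              differentiable_inner differentiable_const diff Mv)+
          (simp add: divu[OF x] dot_lmul_matrix inner_add_left[of "u x v* jacobian v (at x)"])
      then show ?thesis
        by (simp add: ut[OF x] stress K[OF x, symmetric] inner_add_left inner_diff_left
            inner_commute[of _ "u x"] inner_commute[of _ "v x"] inner_add_right inner_diff_right algebra_simps)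
    qed
  qed
qed

section \<open>Constitutive relations\<close>

text \<open>Regularity is assumed for \<Psi> as a function of pairs, whereas the constitutive
  quantities use \<open>deriv\<close> in one variable. Evaluating the joint derivative on the two
  unit vectors connects them.\<close>

lemma Psi_partial_derivs:
  fixes \<Psi> :: "real \<Rightarrow> real \<Rightarrow> real"
  assumes "((\<lambda>(z, \<tau>). \<Psi> z \<tau>) has_derivative D) (at (z, \<tau>))"
  shows "deriv (\<lambda>z. \<Psi> z \<tau>) z = D (1, 0)" "deriv (\<Psi> z) \<tau> = D (0, 1)"
    and "D (h, k) = deriv (\<lambda>z. \<Psi> z \<tau>) z * h + deriv (\<Psi> z) \<tau> * k"
proof -
  have lin: "linear D"
    using assms by (rule has_derivative_linear)
  have D: "D (h, k) = D (1, 0) * h + D (0, 1) * k" for h k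
    using linear_add[OF lin, of "h *\<^sub>R (1, 0)" "k *\<^sub>R (0, 1)"]
      linear_cmul[OF lin, of h "(1, 0)"] linear_cmul[OF lin, of k "(0, 1)"]
    by (simp add: mult.commute)
  have D1: "(\<lambda>h. D (h, 0)) = (*) (D (1, 0))" and D2: "(\<lambda>k. D (0, k)) = (*) (D (0, 1))"
    by (rule ext, rule trans[OF D], simp)+
  have "((\<lambda>z. (z, \<tau>)) has_derivative (\<lambda>h. (h, 0))) (at z)"
    by (intro has_derivative_Pair has_derivative_ident has_derivative_const)
  from has_derivative_compose[OF this assms]
  have "((\<lambda>z. \<Psi> z \<tau>) has_derivative (\<lambda>h. D (h, 0))) (at z)"
    by simp
  then show 1: "deriv (\<lambda>z. \<Psi> z \<tau>) z = D (1, 0)"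
    by (intro DERIV_imp_deriv) (simp add: has_field_derivative_def D1)
  have "((\<lambda>\<tau>. (z, \<tau>)) has_derivative (\<lambda>k. (0, k))) (at \<tau>)"
    by (intro has_derivative_Pair has_derivative_ident has_derivative_const)
  from has_derivative_compose[OF this assms]
  have "(\<Psi> z has_derivative (\<lambda>k. D (0, k))) (at \<tau>)"
    by simp
  then show 2: "deriv (\<Psi> z) \<tau> = D (0, 1)"
    by (intro DERIV_imp_deriv) (simp add: has_field_derivative_def D2)
  show "D (h, k) = deriv (\<lambda>z. \<Psi> z \<tau>) z * h + deriv (\<Psi> z) \<tau> * k"
    unfolding 1 2 by (rule D)
qed

text \<open>One time slice of the solution on the whole space. The fields keep their time argument
  so that the constitutive definitions apply verbatim; positivity of \<open>\<theta> t\<close> is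
  demanded everywhere, which makes all quotients by it C1.\<close>

locale chns_state =
  fixes l \<gamma> :: real and \<Psi> :: "real \<Rightarrow> real \<Rightarrow> real"
    and \<phi> \<theta> \<mu> :: "real \<Rightarrow> real^'n \<Rightarrow> real" and t :: real
  assumes Psi: "Ck_on 2 (\<lambda>(z, \<tau>). \<Psi> z \<tau>) (UNIV \<times> {0<..})"
    and phi: "Ck_on 2 (\<phi> t) UNIV" "periodic l (\<phi> t)"
    and theta: "C1_on UNIV (\<theta> t)" "periodic l (\<theta> t)"
    and theta_pos: "\<And>x. \<theta> t x > 0"
    and mu: "C1_on UNIV (\<mu> t)" "periodic l (\<mu> t)"
begin

lemma phi_C1: "C1_on UNIV (\<phi> t)"
  using phi(1) by (rule Ck_on_2D)

lemma C1_on_constitutive: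
  assumes "C1_on (UNIV \<times> {0<..}) (\<lambda>(z, \<tau>). f z \<tau>)"
  shows "C1_on UNIV (\<lambda>x. f (\<phi> t x) (\<theta> t x))"
  using C1_on_compose[OF assms C1_on_Pair[OF phi_C1 theta(1)]] theta_pos by simp

lemma Psi_has_derivative:
  "((\<lambda>(z, \<tau>). \<Psi> z \<tau>) has_derivative frechet_derivative (\<lambda>(z, \<tau>). \<Psi> z \<tau>) (at (\<phi> t x, \<theta> t x)))
     (at (\<phi> t x, \<theta> t x))"
  using C1_onD(2)[OF Ck_on_2D(1)[OF Psi]] theta_pos by simp

text \<open>The internal energy is the derivative of the C2 function \<Psi> in direction (0,1),
  evaluated along the C1 map (\<phi>, \<theta>).\<close>

lemma internal_energy_C1: "C1_on UNIV (internal_energy \<Psi> \<phi> \<theta> t)"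
proof -
  have "C1_on UNIV (\<lambda>x. frechet_derivative (\<lambda>(z, \<tau>). \<Psi> z \<tau>) (at (\<phi> t x, \<theta> t x)) (0, 1))"
    using C1_on_compose[OF Ck_on_2D(2)[OF Psi] C1_on_Pair[OF phi_C1 theta(1)], of "(0, 1)"] theta_pos
    by (simp add: Basis_prod_def)
  then show ?thesis
    by (simp add: internal_energy_def[abs_def] Psi_partial_derivs(2)[OF Psi_has_derivative])
qed

lemma grad_Psi:
  "grad (\<lambda>x. \<Psi> (\<phi> t x) (\<theta> t x)) x
     = dphi_Psi \<Psi> \<phi> \<theta> t x *\<^sub>R grad (\<phi> t) x + internal_energy \<Psi> \<phi> \<theta> t x *\<^sub>R grad (\<theta> t) x"
proof (rule grad_eqI)
  have "((\<lambda>x. (\<phi> t x, \<theta> t x)) has_derivative (\<lambda>h. (grad (\<phi> t) x \<bullet> h, grad (\<theta> t) x \<bullet> h))) (at x)"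
    by (intro has_derivative_Pair has_derivative_grad C1_onD_UNIV(1) phi_C1 theta)
  from has_derivative_compose[OF this Psi_has_derivative]
  show "((\<lambda>x. \<Psi> (\<phi> t x) (\<theta> t x)) has_derivative
      (\<lambda>h. (dphi_Psi \<Psi> \<phi> \<theta> t x *\<^sub>R grad (\<phi> t) x
        + internal_energy \<Psi> \<phi> \<theta> t x *\<^sub>R grad (\<theta> t) x) \<bullet> h)) (at x)"
    by (simp add: Psi_partial_derivs(3)[OF Psi_has_derivative] dphi_Psi_def internal_energy_def inner_add_left)
qed

lemma grad_phi_C1: "C1_on UNIV (grad (\<phi> t))"
  using phi(1) by (rule C1_on_grad)

lemma Psi_C1: "C1_on UNIV (\<lambda>x. \<Psi> (\<phi> t x) (\<theta> t x))"
  using Ck_on_2D(1)[OF Psi] by (rule C1_on_constitutive)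

lemma entropy_eq:
  "entropy \<gamma> \<Psi> \<phi> \<theta> t = (\<lambda>x. \<theta> t x * internal_energy \<Psi> \<phi> \<theta> t x
     - (\<Psi> (\<phi> t x) (\<theta> t x) + \<gamma>/2 * (grad (\<phi> t) x \<bullet> grad (\<phi> t) x)))"
  by (simp add: entropy_def helmholtz_def power2_norm_eq_inner fun_eq_iff)

lemma entropy_C1: "C1_on UNIV (entropy \<gamma> \<Psi> \<phi> \<theta> t)"
  unfolding entropy_eq
  by (intro C1_on_diff C1_on_add C1_on_mult C1_on_const C1_on_inner internal_energy_C1 Psi_C1
      grad_phi_C1 theta)

lemma korteweg_eq: "korteweg \<gamma> \<phi> \<theta> t = (\<lambda>x. (\<gamma> / \<theta> t x) *\<^sub>R outer (grad (\<phi> t) x))"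
  by (simp add: korteweg_def outer_def fun_eq_iff)

lemma korteweg_C1: "C1_on UNIV (korteweg \<gamma> \<phi> \<theta> t)"
  unfolding korteweg_eq outer_def
  by (intro C1_on_scaleR C1_on_divide C1_on_const C1_on_vec C1_on_mult C1_on_nth grad_phi_C1 theta)
    (use theta_pos in \<open>simp add: less_imp_neq[symmetric]\<close>)

lemma mobility_C1:
  assumes "C1_on (UNIV \<times> UNIV \<times> {0<..}) (\<lambda>(z, g, \<tau>). K z g \<tau>)"
  shows "C1_on UNIV (mobility K \<phi> \<theta> t)"
  using C1_on_compose[OF assms C1_on_Pair[OF phi_C1 C1_on_Pair[OF grad_phi_C1 theta(1)]]] theta_pos
  by (simp add: mobility_def[abs_def])

lemma periodic_state:
  "periodic l (grad (\<phi> t))" "periodic l (internal_energy \<Psi> \<phi> \<theta> t)" "periodic l (entropy \<gamma> \<Psi> \<phi> \<theta> t)"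
  "periodic l (korteweg \<gamma> \<phi> \<theta> t)" "periodic l (mobility K \<phi> \<theta> t)" "periodic l (viscosity \<eta> \<phi> \<theta> t)"
proof -
  show *: "periodic l (grad (\<phi> t))"
    using phi(2) phi_C1 by (rule periodic_grad)
  show "periodic l (internal_energy \<Psi> \<phi> \<theta> t)" "periodic l (entropy \<gamma> \<Psi> \<phi> \<theta> t)"
    "periodic l (korteweg \<gamma> \<phi> \<theta> t)" "periodic l (mobility K \<phi> \<theta> t)" "periodic l (viscosity \<eta> \<phi> \<theta> t)"
    using * phi(2) theta(2)
    by (simp_all add: periodic_def internal_energy_def entropy_def helmholtz_def korteweg_def mobility_def
        viscosity_def)
qed

text \<open>
  The term \<open>\<partial>\<^sub>\<phi>\<Psi> \<nabla>\<phi>/\<theta>\<close> of \<open>\<nabla>e - \<nabla>s/\<theta>\<close> cancels against that of \<open>- \<mu>\<nabla>\<phi>/\<theta>\<close>. What is left is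
  \<open>(\<gamma>/\<theta>)(\<nabla>\<^sup>2\<phi> \<nabla>\<phi> + \<Delta>\<phi> \<nabla>\<phi>)\<close>, that is, \<open>\<gamma>/\<theta>\<close> times the divergence of \<open>\<nabla>\<phi> \<otimes> \<nabla>\<phi>\<close>.
\<close>

lemma korteweg_force:
  assumes "\<mu> t x = - \<gamma> * laplacian (\<phi> t) x + dphi_Psi \<Psi> \<phi> \<theta> t x"
  shows "grad (internal_energy \<Psi> \<phi> \<theta> t) x + (\<phi> t x / \<theta> t x) *\<^sub>R grad (\<mu> t) x
      - korteweg \<gamma> \<phi> \<theta> t x *v (grad (\<theta> t) x /\<^sub>R \<theta> t x)
      - (1 / \<theta> t x) *\<^sub>R grad (\<lambda>x. entropy \<gamma> \<Psi> \<phi> \<theta> t x + \<phi> t x * \<mu> t x) x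
    = matrix_divergence (korteweg \<gamma> \<phi> \<theta> t) x"
proof -
  note diff = phi_C1[THEN C1_onD_UNIV(1)] theta(1)[THEN C1_onD_UNIV(1)] mu(1)[THEN C1_onD_UNIV(1)]
    grad_phi_C1[THEN C1_onD_UNIV(1)] internal_energy_C1[THEN C1_onD_UNIV(1)]
    entropy_C1[THEN C1_onD_UNIV(1)] Psi_C1[THEN C1_onD_UNIV(1)]
  have pos: "\<theta> t x > 0"
    by (rule theta_pos)
  define g where "g = grad (\<phi> t) x"
  define H where "H = jacobian (grad (\<phi> t)) (at x)"
  \<comment> \<open>The single use of the symmetry of the Hessian: the interface energy produces the
    left side, the Korteweg stress the right side.\<close>
  have Hg: "g v* H = H *v g"
    using transpose_hessian[OF phi(1)] by (simp add: H_def flip: transpose_matrix_vector)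
  have "grad (\<lambda>y. \<gamma>/2 * (grad (\<phi> t) y \<bullet> grad (\<phi> t) y)) x = (\<gamma>/2) *\<^sub>R (H *v g + H *v g)"
    by (subst grad_mult) (auto intro: differentiable_inner diff simp: grad_inner diff Hg simp flip: g_def H_def)
  then have grad_interface: "grad (\<lambda>y. \<gamma>/2 * (grad (\<phi> t) y \<bullet> grad (\<phi> t) y)) x = \<gamma> *\<^sub>R (H *v g)"
    by (simp only: scaleR_add_right scaleR_add_left[symmetric] field_sum_of_halves)
  \<comment> \<open>The term e\<nabla>\<theta> from the product \<theta>e cancels against the
    \<theta>-part of \<nabla>\<Psi>, because e is the derivative of \<Psi> in \<theta>.\<close>
  have grad_s: "grad (entropy \<gamma> \<Psi> \<phi> \<theta> t) x = \<theta> t x *\<^sub>R grad (internal_energy \<Psi> \<phi> \<theta> t) x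
      - dphi_Psi \<Psi> \<phi> \<theta> t x *\<^sub>R g - \<gamma> *\<^sub>R (H *v g)"
    unfolding entropy_eq
    by (subst grad_diff grad_add grad_interface grad_mult grad_Psi
        | intro differentiable_add differentiable_mult differentiable_const differentiable_inner diff)+
      (simp add: algebra_simps flip: g_def)
  have grad_r: "grad (\<lambda>x. entropy \<gamma> \<Psi> \<phi> \<theta> t x + \<phi> t x * \<mu> t x) x
      = grad (entropy \<gamma> \<Psi> \<phi> \<theta> t) x + (\<phi> t x *\<^sub>R grad (\<mu> t) x + \<mu> t x *\<^sub>R g)"
    by (simp add: grad_add grad_mult differentiable_mult diff g_def)
  have div_korteweg: "matrix_divergence (korteweg \<gamma> \<phi> \<theta> t) x = (\<gamma> / \<theta> t x) *\<^sub>R (H *v g)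
      + (- (\<gamma> / (\<theta> t x)\<^sup>2) * (grad (\<theta> t) x \<bullet> g) + \<gamma> / \<theta> t x * laplacian (\<phi> t) x) *\<^sub>R g"
  proof -
    have "(\<lambda>x. \<gamma> / \<theta> t x) differentiable (at x)"
      by (intro C1_onD_UNIV(1) C1_on_divide C1_on_const theta(1)) (metis theta_pos less_irrefl)
    then show ?thesis
      unfolding korteweg_eq
      using pos by (simp add: matrix_divergence_scaleR_outer grad_const_divide diff g_def H_def laplacian_def)
  qed
  \<comment> \<open>This is exactly the part of div \<sigma> in which the derivative falls on
    1/\<theta>, up to sign.\<close>
  have korteweg_theta: "korteweg \<gamma> \<phi> \<theta> t x *v (grad (\<theta> t) x /\<^sub>R \<theta> t x)
      = (\<gamma> / (\<theta> t x)\<^sup>2 * (grad (\<theta> t) x \<bullet> g)) *\<^sub>R g"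
    by (simp add: korteweg_eq scaleR_matrix_vector_assoc[symmetric] outer_mult_vector g_def[symmetric]
        inner_commute power2_eq_square divide_simps)
  show ?thesis
    unfolding div_korteweg korteweg_theta grad_r grad_s assms
    using pos by (simp add: vec_eq_iff field_simps power2_eq_square)
qed

end

section \<open>Time slices of a classical solution and assembly of the weak system\<close>

lemma periodic_sym_grad: "periodic l u \<Longrightarrow> C1_on UNIV u \<Longrightarrow> periodic l (sym_grad u)"
  using periodic_jacobian[of l u] by (simp add: periodic_def sym_grad_def)

lemma C0_Ck_D: "C0_Ck l T k f \<Longrightarrow> t \<in> {0<..T} \<Longrightarrow> Ck_per l k (f t)"
  by (simp add: C0_Ck_def)

lemma C1_Ck_D: "C1_Ck l T k f \<Longrightarrow> t \<in> {0<..T} \<Longrightarrow> Ck_per l k (f t)"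
  by (simp add: C1_Ck_def)

lemma Ck_per_mono: "Ck_per l k f \<Longrightarrow> j \<le> k \<Longrightarrow> Ck_per l j f"
  by (auto simp: Ck_per_def intro: Ck_on_mono)

lemma block_matrix_nth:
  "block_matrix A B C D $ Inl i $ Inl j = A $ i $ j"
  "block_matrix A B C D $ Inl i $ Inr j = B $ i $ j"
  "block_matrix A B C D $ Inr i $ Inr j = D $ i $ j"
  by (simp_all add: block_matrix_def)

theorem lemma1:
  fixes a :: "real^'n" and l T \<gamma> :: real
    and \<Psi> \<eta> :: "real \<Rightarrow> real \<Rightarrow> real"
    and L11 L12 L22 :: "real \<Rightarrow> real^'n \<Rightarrow> real \<Rightarrow> real^'n^'n"
    and \<phi> \<mu> \<theta> p :: "real \<Rightarrow> real^'n \<Rightarrow> real"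
    and u :: "real \<Rightarrow> real^'n \<Rightarrow> real^'n"
  assumes dim: "CARD('n) = 2 \<or> CARD('n) = 3"
    and "l > 0" and "T > 0"
    and coeffs: "chns_coefficients \<gamma> \<Psi> \<eta> L11 L12 L22"
    and sol: "chns_classical_solution a l T \<gamma> \<Psi> \<eta> L11 L12 L22 \<phi> \<mu> \<theta> u p"
  shows
   "let \<Omega> = cube a l;
        e = internal_energy \<Psi> \<phi> \<theta>;
        s = entropy \<gamma> \<Psi> \<phi> \<theta>;
        \<sigma> = korteweg \<gamma> \<phi> \<theta>;
        M11 = mobility L11 \<phi> \<theta>;
        M12 = mobility L12 \<phi> \<theta>;
        M22 = mobility L22 \<phi> \<theta>;
        \<nu> = viscosity \<eta> \<phi> \<theta>;
        \<pi> = (\<lambda>t x. p t x + e t x - (s t x + \<phi> t x * \<mu> t x) / \<theta> t x)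
    in \<forall>t\<in>{0<..T}. \<forall>\<psi> \<xi> w q v.
         Ck_per l 1 \<psi> \<and> Ck_per l 1 \<xi> \<and> Ck_per l 1 w \<and> Ck_per l 1 q \<and> Ck_per l 1 v \<longrightarrow>
         (0 = \<langle>time_deriv T \<phi> t, \<psi>\<rangle>\<^bsub>\<Omega>\<^esub>
              - \<langle>\<lambda>x. \<phi> t x *\<^sub>R u t x, grad \<psi>\<rangle>\<^bsub>\<Omega>\<^esub>
              + \<langle>\<lambda>x. M11 t x *v grad (\<mu> t) x - M12 t x *v grad (\<theta> t) x, grad \<psi>\<rangle>\<^bsub>\<Omega>\<^esub>)
       \<and> (0 = \<langle>\<mu> t, \<xi>\<rangle>\<^bsub>\<Omega>\<^esub>
              - \<gamma> * \<langle>grad (\<phi> t), grad \<xi>\<rangle>\<^bsub>\<Omega>\<^esub>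
              - \<langle>dphi_Psi \<Psi> \<phi> \<theta> t, \<xi>\<rangle>\<^bsub>\<Omega>\<^esub>)
       \<and> (0 = \<langle>time_deriv T e t, w\<rangle>\<^bsub>\<Omega>\<^esub>
              + \<langle>\<lambda>x. M12 t x *v grad (\<mu> t) x - M22 t x *v grad (\<theta> t) x, grad w\<rangle>\<^bsub>\<Omega>\<^esub>
              - \<langle>\<lambda>x. \<nu> t x * (norm (sym_grad (u t) x))\<^sup>2, w\<rangle>\<^bsub>\<Omega>\<^esub>
              - \<langle>\<lambda>x. \<sigma> t x *v u t x, grad w\<rangle>\<^bsub>\<Omega>\<^esub>
              - \<langle>\<lambda>x. (\<phi> t x / \<theta> t x) *\<^sub>R grad (\<mu> t) x - \<sigma> t x *v (grad (\<theta> t) x /\<^sub>R \<theta> t x),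
                 \<lambda>x. w x *\<^sub>R u t x\<rangle>\<^bsub>\<Omega>\<^esub>
              - \<langle>\<lambda>x. s t x + \<phi> t x * \<mu> t x, \<lambda>x. u t x \<bullet> grad (\<lambda>y. w y / \<theta> t y) x\<rangle>\<^bsub>\<Omega>\<^esub>)
       \<and> (0 = \<langle>time_deriv T u t, v\<rangle>\<^bsub>\<Omega>\<^esub>
              + conv_skw \<Omega> (u t) (u t) v
              + \<langle>\<lambda>x. \<nu> t x *\<^sub>R sym_grad (u t) x, sym_grad v\<rangle>\<^bsub>\<Omega>\<^esub>
              - \<langle>\<pi> t, divergence v\<rangle>\<^bsub>\<Omega>\<^esub>
              + \<langle>\<lambda>x. (\<phi> t x / \<theta> t x) *\<^sub>R grad (\<mu> t) x
                      + (s t x + \<phi> t x * \<mu> t x) *\<^sub>R grad (\<lambda>y. 1 / \<theta> t y) x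
                      - \<sigma> t x *v (grad (\<theta> t) x /\<^sub>R \<theta> t x), v\<rangle>\<^bsub>\<Omega>\<^esub>)
       \<and> (0 = \<langle>divergence (u t), q\<rangle>\<^bsub>\<Omega>\<^esub>)"
proof -
  interpret coeffs: chns_coefficients \<gamma> \<Psi> \<eta> L11 L12 L22
    by (rule coeffs)
  interpret sol: chns_classical_solution a l T \<gamma> \<Psi> \<eta> L11 L12 L22 \<phi> \<mu> \<theta> u p
    by (rule sol)
  \<comment> \<open>Smoothness is assumed for the full diffusion matrix; the blocks inherit it as
    families of entries, \<open>L12\<close> up to sign.\<close>
  define B where "B = (\<lambda>(z, g, \<tau>). block_matrix (L11 z g \<tau>) (- L12 z g \<tau>) (- L12 z g \<tau>) (L22 z g \<tau>))"
  have B: "C1_on (UNIV \<times> UNIV \<times> {0<..}) B"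
    using coeffs.L_C1 unfolding Ck_on_1_iff B_def .
  have L11: "(\<lambda>(z, g, \<tau>). L11 z g \<tau>) = (\<lambda>x. \<chi> i j. B x $ Inl i $ Inl j)"
    and L12: "(\<lambda>(z, g, \<tau>). L12 z g \<tau>) = (\<lambda>x. \<chi> i j. - B x $ Inl i $ Inr j)"
    and L22: "(\<lambda>(z, g, \<tau>). L22 z g \<tau>) = (\<lambda>x. \<chi> i j. B x $ Inr i $ Inr j)"
    by (auto simp: B_def block_matrix_nth fun_eq_iff vec_eq_iff)
  have L: "C1_on (UNIV \<times> UNIV \<times> {0<..}) (\<lambda>(z, g, \<tau>). L11 z g \<tau>)"
      "C1_on (UNIV \<times> UNIV \<times> {0<..}) (\<lambda>(z, g, \<tau>). L12 z g \<tau>)"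
      "C1_on (UNIV \<times> UNIV \<times> {0<..}) (\<lambda>(z, g, \<tau>). L22 z g \<tau>)"
    unfolding L11 L12 L22 by (intro C1_on_vec C1_on_minus C1_on_nth B)+
  have \<eta>: "C1_on (UNIV \<times> {0<..}) (\<lambda>(z, \<tau>). \<eta> z \<tau>)"
    using coeffs.eta_C1 unfolding Ck_on_1_iff .
  show ?thesis
    unfolding Let_def
  proof (intro ballI allI impI, elim conjE, goal_cases)
    case (1 t \<psi> \<xi> w q v)
    note t = 1(1) and test = 1(2-6)
    note reg2 = Ck_per_mono[OF C1_Ck_D[OF sol.phi_reg t], of 2, simplified] C0_Ck_D[OF sol.mu_reg t]
      C1_Ck_D[OF sol.theta_reg t] C1_Ck_D[OF sol.u_reg t]
    have reg: "Ck_per l 1 (\<phi> t)" "Ck_per l 1 (\<mu> t)" "Ck_per l 1 (\<theta> t)" "Ck_per l 1 (u t)" "Ck_per l 1 (p t)"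
      by (rule Ck_per_mono[OF reg2(1)] Ck_per_mono[OF reg2(2)] Ck_per_mono[OF reg2(3)]
          Ck_per_mono[OF reg2(4)] Ck_per_mono[OF C0_Ck_D[OF sol.p_reg t]]; simp)+
    \<comment> \<open>Positivity is given on the cube, and periodicity extends it.\<close>
    have pos: "\<theta> t x > 0" for x
      using periodic_representative[of l "\<theta> t" a x] reg(3) \<open>l > 0\<close> sol.theta_pos[OF t]
      unfolding Ck_per_1_iff by metis
    interpret st: chns_state l \<gamma> \<Psi> \<phi> \<theta> \<mu> t
      using coeffs.Psi_C2 reg reg2 pos unfolding Ck_per_1_iff
      by unfold_locales (simp_all add: Ck_per_def)
    define r where "r = (\<lambda>x. entropy \<gamma> \<Psi> \<phi> \<theta> t x + \<phi> t x * \<mu> t x)"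
    define J1 where "J1 = (\<lambda>y. mobility L11 \<phi> \<theta> t y *v grad (\<mu> t) y - mobility L12 \<phi> \<theta> t y *v grad (\<theta> t) y)"
    define J2 where "J2 = (\<lambda>y. mobility L12 \<phi> \<theta> t y *v grad (\<mu> t) y - mobility L22 \<phi> \<theta> t y *v grad (\<theta> t) y)"
    have grads: "C1_on UNIV (grad (\<phi> t))" "C1_on UNIV (grad (\<mu> t))" "C1_on UNIV (grad (\<theta> t))"
        "C1_on UNIV (sym_grad (u t))"
      using reg2 by (auto simp: Ck_per_def intro: C1_on_grad C1_on_sym_grad)
    have pers: "periodic l (grad (\<phi> t))" "periodic l (grad (\<mu> t))" "periodic l (grad (\<theta> t))"
        "periodic l (sym_grad (u t))"
      using reg unfolding Ck_per_1_iff by (auto intro: periodic_grad periodic_sym_grad)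
    \<comment> \<open>The diffusive fluxes are C1 because the mobilities are C1 in (\<phi>,
      \<nabla>\<phi>, \<theta>) and \<mu>, \<theta> are C2 in space.\<close>
    have J: "Ck_per l 1 J1" "Ck_per l 1 J2"
      unfolding Ck_per_1_iff J1_def J2_def using pers st.periodic_state(5)
      by (auto intro!: C1_on_diff C1_on_matrix_vector_mult st.mobility_C1 L grads simp: periodic_def)
    have e: "Ck_per l 1 (internal_energy \<Psi> \<phi> \<theta> t)" and \<sigma>: "Ck_per l 1 (korteweg \<gamma> \<phi> \<theta> t)"
      and Du: "Ck_per l 1 (sym_grad (u t))" and Dphi: "Ck_per l 1 (grad (\<phi> t))"
      unfolding Ck_per_1_iff
      using st.internal_energy_C1 st.korteweg_C1 st.periodic_state pers grads by auto
    have \<nu>: "Ck_per l 1 (viscosity \<eta> \<phi> \<theta> t)"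
      unfolding Ck_per_1_iff using st.C1_on_constitutive[OF \<eta>] st.periodic_state(6)
      by (simp add: viscosity_def[abs_def])
    have r: "Ck_per l 1 r"
      using reg st.periodic_state(3) unfolding Ck_per_1_iff r_def
      by (auto intro!: C1_on_add C1_on_mult st.entropy_C1 simp: periodic_def)
    have sym: "transpose (korteweg \<gamma> \<phi> \<theta> t x) = korteweg \<gamma> \<phi> \<theta> t x" for x
      by (simp add: korteweg_def transpose_def vec_eq_iff mult.commute)
    have neq: "\<theta> t x \<noteq> 0" for x
      using pos[of x] by simp
    have cont: "continuous_on S f" if "Ck_per l 1 f" for S and f :: "real^'n \<Rightarrow> 'z::real_normed_vector"
      using that unfolding Ck_per_1_iff by (blast intro: C1_onD_UNIV(2))
    have cont_grads: "continuous_on S (grad (\<mu> t))" "continuous_on S (grad (\<theta> t))" for S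
      using grads by (auto intro: C1_onD_UNIV(2))
    have cont_forces:
      "continuous_on (cube a l) (\<lambda>x. (\<phi> t x / \<theta> t x) *\<^sub>R grad (\<mu> t) x)"
      "continuous_on (cube a l) (\<lambda>x. korteweg \<gamma> \<phi> \<theta> t x *v (grad (\<theta> t) x /\<^sub>R \<theta> t x))"
      using neq by (intro continuous_on_matrix_vector_mult continuous_intros cont[OF reg(1)] cont[OF reg(3)]
          cont[OF \<sigma>] cont_grads; simp)+
    \<comment> \<open>The hypothesis \<open>K\<close> of the energy and momentum lemmas; it holds on
      the cube, where the equation for \<mu> is available.\<close>
    have force: "grad (internal_energy \<Psi> \<phi> \<theta> t) x + (\<phi> t x / \<theta> t x) *\<^sub>R grad (\<mu> t) x
        - korteweg \<gamma> \<phi> \<theta> t x *v (grad (\<theta> t) x /\<^sub>R \<theta> t x) - (1 / \<theta> t x) *\<^sub>R grad r x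
      = matrix_divergence (korteweg \<gamma> \<phi> \<theta> t) x" if "x \<in> cube a l" for x
      unfolding r_def by (rule st.korteweg_force[OF sol.potential_eq[OF t that]])
    note weak_transport_diffusion[OF \<open>l > 0\<close> reg(1) test(1) reg(4) J(1) sol.incompressible[OF t]
        sol.phase_eq[OF t, folded J1_def]]
    moreover note weak_poisson[OF \<open>l > 0\<close> test(2) Dphi cont[OF reg(2)]
        sol.potential_eq[OF t, unfolded laplacian_def]]
    moreover note weak_energy[OF \<open>l > 0\<close> e reg(3) r test(3) reg(4) J(2) \<sigma> cont[OF \<nu>] cont_forces neq sym
        sol.incompressible[OF t] force sol.energy_eq[OF t, folded J2_def]]
    moreover note weak_momentum[OF \<open>l > 0\<close> e reg(3) r reg(5) reg(4) test(5) \<sigma> \<nu> Du cont_forces neq sym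
        sol.incompressible[OF t] force sol.momentum_eq[OF t]]
    \<comment> \<open>The integrand vanishes pointwise on the cube.\<close>
    moreover have "\<langle>divergence (u t), q\<rangle>\<^bsub>cube a l\<^esub> = 0"
      unfolding L2_inner_def by (rule integral_unique, rule has_integral_eq[OF _ has_integral_0])
        (simp add: sol.incompressible[OF t])
    ultimately show ?case
      unfolding r_def J1_def J2_def by (intro conjI; simp only:)
  qed
qed

end
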